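(* Consider $\min_{\mathbf{X}\in\mathbb{S}_+^n} f(\mathcal{G}(\mathbf{X})-\mathbf{z})$ and write $f\circ\mathcal{G}(\mathbf{X}):=f(\mathcal{G}(\mathbf{X})-\mathbf{z})$. Suppose $f\circ\mathcal{G}$ has $L_{f\circ\mathcal{G}}$-Lipschitz continuous gradient, $f$ has $L_f$-Lipschitz continuous gradient, $f$ is strictly convex, and $\|\mathcal{G}^*(\mathbf{a})\|_*\le\bar{G}\|\mathbf{a}\|_*$ for all $\mathbf{a}\in\mathbb{R}^d$. Let $\mathbf{X}^*$ be an optimal solution. Then the memory efficient MOCO algorithm (given in the context) ensures that $$\big[\mathrm{dist}_*\big(\mathcal{G}^*(\tilde{\mathbf{g}}_k),\mathbb{S}_+^n\big)\big]^2\ \le\ \mathcal{O}\!\left(\frac{\bar{G}^2L_fL_{f\circ\mathcal{G}}\|\mathbf{X}^*\|^2}{k}\right),$$ i.e. there is an absolute constant $C>0$ such that the left-hand side is at most $C\,\bar{G}^2L_fL_{f\circ\mathcal{G}}\|\mathbf{X}^*\|^2/k$ for all $k\ge 1$.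
   Context: $\mathbb{S}^n$ is the space of real symmetric $n\times n$ matrices (trace inner product), $\mathbb{S}_+^n$ its positive semidefinite cone (self-dual), $\mathbf{z}\in\mathbb{R}^d$ a given vector, $\mathbf{G}_1,\dots,\mathbf{G}_d\in\mathbb{S}^n$, $\mathcal{G}(\mathbf{X})=[\mathrm{tr}(\mathbf{G}_1\mathbf{X}),\dots,\mathrm{tr}(\mathbf{G}_d\mathbf{X})]^\top$, with adjoint $\mathcal{G}^*(\mathbf{a})=\sum_i a_i\mathbf{G}_i$. The function $f:\mathrm{dom}\,f\subseteq\mathbb{R}^d\to\mathbb{R}$ is differentiable. For matrices, $\|\cdot\|$ is the Schatten 1-norm (nuclear norm) and its dual norm $\|\cdot\|_*$ is the operator norm; for vectors, $\|\cdot\|$ is any norm, with dual $\|\cdot\|_*$. Lipschitz gradient with constant $L$ means $\|\nabla h(u)-\nabla h(w)\|_*\le L\|u-w\|$ in the respective norms. $\mathrm{dist}_*$ is the distance in the dual (operator) norm. Memory efficient MOCO: set $\mathbf{y}_0=-\mathbf{z}$, $\mathbf{X}_0=\mathbf{0}$, $\delta_k=\frac{2}{k+2}$. For $k=0,1,\dots$ (each argmin denotes a chosen minimizer, assumed to be attained): (1) $\eta_k\in\arg\min_{\eta\ge0}f(\eta\mathbf{y}_k+\eta\mathbf{z}-\mathbf{z})$; (2) $\tilde{\mathbf{g}}_k=(1-\delta_k)\tilde{\mathbf{g}}_{k-1}+\delta_k\nabla f(\eta_k\mathbf{y}_k+\eta_k\mathbf{z}-\mathbf{z})$ (since $\delta_0=1$,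 $\tilde{\mathbf{g}}_{-1}$ is irrelevant); (3) $\lambda_k=\lambda_{\min}(\mathcal{G}^*(\tilde{\mathbf{g}}_k))$ with associated normalized eigenvector $\mathbf{q}_k$; (4) $\theta_k\in\arg\min_{\theta\ge0}f(\eta_k\mathbf{y}_k+\eta_k\mathbf{z}-\mathbf{z}+\theta\,\mathcal{G}(\mathbf{q}_k\mathbf{q}_k^\top))$; (5) $\mathbf{y}_{k+1}=\eta_k\mathbf{y}_k+\eta_k\mathbf{z}-\mathbf{z}+\theta_k\mathcal{G}(\mathbf{q}_k\mathbf{q}_k^\top)$, and implicitly $\mathbf{X}_{k+1}=\eta_k\mathbf{X}_k+\theta_k\mathbf{q}_k\mathbf{q}_k^\top$, so that $\mathbf{y}_k=\mathcal{G}(\mathbf{X}_k)-\mathbf{z}$. (The algorithm also updates a random sketch of $\mathbf{X}_k$, which does not influence these iterates.) *)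

theory Defs
  imports Complex_Main "Jordan_Normal_Form.Char_Poly"
begin

text \<open>
  The bound has a constant that does not depend on the dimensions, so the dimensions must be
  quantified inside the statement. Vectors and matrices are therefore those of
  Jordan\_Normal\_Form with explicit carriers, and since these types carry no topology, gradients
  and open sets are spelled out for a space with carrier \<open>V\<close> and inner product \<open>ip\<close>.
\<close>

definition mat_trace :: "real mat \<Rightarrow> real" where
  "mat_trace A = (\<Sum>i<dim_row A. A $$ (i, i))"

definition sym_mats :: "nat \<Rightarrow> real mat set" where
  "sym_mats n = {A \<in> carrier_mat n n. transpose_mat A = A}"

definition psd_cone :: "nat \<Rightarrow> real mat set" where
  "psd_cone n = {A \<in> sym_mats n. \<forall>x \<in> carrier_vec n. 0 \<le> x \<bullet> (A *\<^sub>v x)}"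

definition trace_inner :: "real mat \<Rightarrow> real mat \<Rightarrow> real" where
  "trace_inner A B = mat_trace (A * B)"

definition outer_square :: "real vec \<Rightarrow> real mat" where
  "outer_square q = mat (dim_vec q) (dim_vec q) (\<lambda>(i, j). q $ i * q $ j)"

definition lambda_min :: "real mat \<Rightarrow> real" where
  "lambda_min A = Min {l. eigenvalue A l}"

text \<open>The spectral norm, induced by the Euclidean norm.\<close>

definition op_norm :: "real mat \<Rightarrow> real" where
  "op_norm A = (SUP x \<in> {x \<in> carrier_vec (dim_col A). x \<bullet> x \<le> 1}. sqrt ((A *\<^sub>v x) \<bullet> (A *\<^sub>v x)))"

text \<open>The Schatten 1-norm is the trace of \<open>\<bar>A\<bar>\<close>, the unique positive semidefinite square root
  of \<open>A\<^sup>T A\<close>; equivalently, the sum of the singular values of \<open>A\<close>.\<close>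

definition mat_abs :: "real mat \<Rightarrow> real mat" where
  "mat_abs A = (THE B. B \<in> psd_cone (dim_col A) \<and> B * B = transpose_mat A * A)"

definition nuclear_norm :: "real mat \<Rightarrow> real" where
  "nuclear_norm A = mat_trace (mat_abs A)"

definition dist_op :: "real mat \<Rightarrow> real mat set \<Rightarrow> real" where
  "dist_op A K = (INF P \<in> K. op_norm (A - P))"

definition is_vec_norm :: "nat \<Rightarrow> (real vec \<Rightarrow> real) \<Rightarrow> bool" where
  "is_vec_norm d N \<longleftrightarrow>
     (\<forall>x \<in> carrier_vec d. 0 \<le> N x \<and> (N x = 0 \<longleftrightarrow> x = 0\<^sub>v d)) \<and>
     (\<forall>c. \<forall>x \<in> carrier_vec d. N (c \<cdot>\<^sub>v x) = \<bar>c\<bar> * N x) \<and>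
     (\<forall>x \<in> carrier_vec d. \<forall>y \<in> carrier_vec d. N (x + y) \<le> N x + N y)"

definition dual_norm :: "nat \<Rightarrow> (real vec \<Rightarrow> real) \<Rightarrow> real vec \<Rightarrow> real" where
  "dual_norm d N a = (SUP x \<in> {x \<in> carrier_vec d. N x \<le> 1}. a \<bullet> x)"

definition open_subset :: "'a::plus set \<Rightarrow> ('a \<Rightarrow> 'a \<Rightarrow> real) \<Rightarrow> 'a set \<Rightarrow> bool" where
  "open_subset V ip U \<longleftrightarrow>
     U \<subseteq> V \<and> (\<forall>x \<in> U. \<exists>r>0. \<forall>v \<in> V. sqrt (ip v v) < r \<longrightarrow> x + v \<in> U)"

text \<open>Frechet gradient. The norm measuring the increment is the one of the inner product; as the
  spaces are finite-dimensional, any other norm gives the same notion.\<close>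

definition has_gradient ::
  "'a::plus set \<Rightarrow> ('a \<Rightarrow> 'a \<Rightarrow> real) \<Rightarrow> ('a \<Rightarrow> real) \<Rightarrow> 'a \<Rightarrow> 'a \<Rightarrow> bool" where
  "has_gradient V ip h x g \<longleftrightarrow>
     g \<in> V \<and>
     (\<forall>e>0. \<exists>r>0. \<forall>v \<in> V. sqrt (ip v v) < r \<longrightarrow>
        \<bar>h (x + v) - h x - ip g v\<bar> \<le> e * sqrt (ip v v))"

definition gradient ::
  "'a::plus set \<Rightarrow> ('a \<Rightarrow> 'a \<Rightarrow> real) \<Rightarrow> ('a \<Rightarrow> real) \<Rightarrow> 'a \<Rightarrow> 'a" where
  "gradient V ip h x = (THE g. has_gradient V ip h x g)"

definition differentiable_on_set ::
  "'a::plus set \<Rightarrow> ('a \<Rightarrow> 'a \<Rightarrow> real) \<Rightarrow> 'a set \<Rightarrow> ('a \<Rightarrow> real) \<Rightarrow> bool" where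
  "differentiable_on_set V ip U h \<longleftrightarrow> (\<forall>x \<in> U. \<exists>g. has_gradient V ip h x g)"

definition lipschitz_gradient ::
  "'a::{plus,minus} set \<Rightarrow> ('a \<Rightarrow> 'a \<Rightarrow> real) \<Rightarrow> ('a \<Rightarrow> real) \<Rightarrow> ('a \<Rightarrow> real) \<Rightarrow>
   'a set \<Rightarrow> ('a \<Rightarrow> real) \<Rightarrow> real \<Rightarrow> bool" where
  "lipschitz_gradient V ip nrm nrm_dual U h L \<longleftrightarrow>
     differentiable_on_set V ip U h \<and>
     (\<forall>u \<in> U. \<forall>w \<in> U. nrm_dual (gradient V ip h u - gradient V ip h w) \<le> L * nrm (u - w))"

definition strictly_convex_on :: "real vec set \<Rightarrow> (real vec \<Rightarrow> real) \<Rightarrow> bool" where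
  "strictly_convex_on D f \<longleftrightarrow>
     (\<forall>u \<in> D. \<forall>w \<in> D. \<forall>t. 0 < t \<and> t < 1 \<longrightarrow>
        t \<cdot>\<^sub>v u + (1 - t) \<cdot>\<^sub>v w \<in> D \<and>
        (u \<noteq> w \<longrightarrow> f (t \<cdot>\<^sub>v u + (1 - t) \<cdot>\<^sub>v w) < t * f u + (1 - t) * f w))"

definition G_map :: "nat \<Rightarrow> (nat \<Rightarrow> real mat) \<Rightarrow> real mat \<Rightarrow> real vec" where
  "G_map d G X = vec d (\<lambda>i. mat_trace (G i * X))"

text \<open>\<open>\<Sum>i<d. a\<^sub>i G\<^sub>i\<close>, written entrywise because matrices of a fixed size are not a
  type-class monoid.\<close>

definition G_adj :: "nat \<Rightarrow> nat \<Rightarrow> (nat \<Rightarrow> real mat) \<Rightarrow> real vec \<Rightarrow> real mat" where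
  "G_adj n d G a = mat n n (\<lambda>(i, j). \<Sum>l<d. a $ l * G l $$ (i, j))"

text \<open>A run of the algorithm for \<open>f\<close> with effective domain \<open>D\<close>. The line searches range over the
  nonnegative steps that stay in \<open>D\<close>. The argument \<open>g_init\<close> stands for the momentum vector with
  index \<open>-1\<close>; its weight is \<open>0\<close>.\<close>

definition moco_run ::
  "nat \<Rightarrow> nat \<Rightarrow> real vec set \<Rightarrow> (real vec \<Rightarrow> real) \<Rightarrow> (nat \<Rightarrow> real mat) \<Rightarrow> real vec \<Rightarrow>
   (nat \<Rightarrow> real vec) \<Rightarrow> (nat \<Rightarrow> real mat) \<Rightarrow> (nat \<Rightarrow> real) \<Rightarrow> real vec \<Rightarrow> (nat \<Rightarrow> real vec) \<Rightarrow>
   (nat \<Rightarrow> real) \<Rightarrow> (nat \<Rightarrow> real vec) \<Rightarrow> (nat \<Rightarrow> real) \<Rightarrow> bool" where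
  "moco_run n d D f G z y X \<eta> g_init g lam q \<theta> \<longleftrightarrow>
     y 0 = - z \<and> X 0 = 0\<^sub>m n n \<and> g_init \<in> carrier_vec d \<and>
     (\<forall>k. let \<delta> = 2 / (real k + 2);
              p = (\<lambda>s. s \<cdot>\<^sub>v y k + s \<cdot>\<^sub>v z - z);
              u = p (\<eta> k);
              Q = outer_square (q k)
          in is_arg_min (\<lambda>s. f (p s)) (\<lambda>s. 0 \<le> s \<and> p s \<in> D) (\<eta> k) \<and>
             g k = (1 - \<delta>) \<cdot>\<^sub>v (case k of 0 \<Rightarrow> g_init | Suc j \<Rightarrow> g j)
                   + \<delta> \<cdot>\<^sub>v gradient (carrier_vec d) (\<bullet>) f u \<and>
             lam k = lambda_min (G_adj n d G (g k)) \<and>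
             eigenvector (G_adj n d G (g k)) (q k) (lam k) \<and> q k \<bullet> q k = 1 \<and>
             is_arg_min (\<lambda>s. f (u + s \<cdot>\<^sub>v G_map d G Q))
               (\<lambda>s. 0 \<le> s \<and> u + s \<cdot>\<^sub>v G_map d G Q \<in> D) (\<theta> k) \<and>
             y (Suc k) = u + \<theta> k \<cdot>\<^sub>v G_map d G Q \<and>
             X (Suc k) = \<eta> k \<cdot>\<^sub>m X k + \<theta> k \<cdot>\<^sub>m Q)"

end

theory Submission
  imports Defs
begin

text \<open>
  Write \<open>h A = f (\<G> A - z)\<close>, let \<open>x\<^sub>k = \<eta>\<^sub>k X\<^sub>k\<close> be the iterate after the scaling search, and let
  \<open>M\<^sub>k = \<G>\<^sup>* g\<^sub>k\<close> be the averaged gradient. The distance of \<open>M\<^sub>k\<close> to the cone is at most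
  \<open>v\<^sub>k = max 0 (- \<lambda>\<^sub>m\<^sub>i\<^sub>n M\<^sub>k)\<close>, so a bound on \<open>v\<^sub>k\<close> is wanted.

  The scaling search makes \<open>\<nabla>h x\<^sub>k\<close> orthogonal to \<open>x\<^sub>k\<close>. Hence the tangent of \<open>h\<close> at \<open>x\<^sub>k\<close> is
  \<open>W \<mapsto> h x\<^sub>k + tr (\<nabla>h x\<^sub>k W)\<close>, and averaging the tangents with the momentum weights gives a lower bound
  \<open>W \<mapsto> c\<^sub>k + tr (M\<^sub>k W)\<close> of \<open>h\<close>, where \<open>c\<^sub>k\<close> is the same average of the values \<open>h x\<^sub>j\<close>. On the matrices of
  the cone with trace at most \<open>R\<close> this bound has the minimum \<open>c\<^sub>k - R v\<^sub>k\<close>. The search along \<open>q\<^sub>k q\<^sub>k\<^sup>T\<close> is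
  at least as good as a Frank-Wolfe step \<open>\<delta>\<^sub>k R q\<^sub>k q\<^sub>k\<^sup>T\<close>, and the usual recursion yields
  \<open>h x\<^sub>k\<^sub>+\<^sub>1 - c\<^sub>k + R v\<^sub>k \<le> 2 L R\<^sup>2 / (k + 2)\<close> for every \<open>R\<close> at once (\<open>truncated_gap\<close>).

  With \<open>R = tr X\<^sup>*\<close> the gap dominates \<open>h x\<^sub>k\<^sub>+\<^sub>1 - h X\<^sup>*\<close>, so the objective converges at the rate \<open>1/k\<close>
  (\<open>objective_rate\<close>), and so does its average \<open>c\<^sub>k\<close> (\<open>avg_rate\<close>). As \<open>h x\<^sub>k\<^sub>+\<^sub>1 \<ge> h X\<^sup>*\<close>, the gap estimate
  then leaves \<open>R v\<^sub>k \<le> (2 L R\<^sup>2 + 4 L (tr X\<^sup>*)\<^sup>2) / (k + 2)\<close>, that is \<open>v\<^sub>k \<le> 6 L tr X\<^sup>* / (k + 2)\<close>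
  (\<open>violation_rate\<close>). The square of this decays even like \<open>1/k\<^sup>2\<close>.

  Here \<open>L\<close> may be the smoothness constant \<open>L\<^sub>f\<^sub>G\<close> of \<open>f \<circ> \<G>\<close>, but also \<open>G\<^sub>b\<^sub>a\<^sub>r\<^sup>2 L\<^sub>f\<close>, because the bound on
  \<open>\<G>\<^sup>*\<close> dualizes to one on \<open>\<G>\<close>. The product in the statement appears since the square of the smaller
  of the two constants is at most their product. The dualization needs functionals that attain a given
  norm, hence the finite-dimensional Hahn-Banach theorem (\<open>sublinear_support\<close>).

  The matrix facts that enter are the inequality \<open>tr (A P) \<ge> 0\<close> for positive semidefinite \<open>A\<close>, \<open>P\<close>
  (\<open>trace_inner_psd_nonneg\<close>), the uniqueness of the positive semidefinite square root, which makes the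
  nuclear norm a trace on the cone, and the variational characterization of the smallest eigenvalue
  (\<open>lambda_min_le_form\<close>). They are derived from Cauchy-Schwarz for semidefinite forms.
\<close>

section \<open>Symmetric and positive semidefinite matrices\<close>

lemma psd_coneD:
  assumes "P \<in> psd_cone n"
  shows "P \<in> carrier_mat n n" and "P \<in> sym_mats n" and "transpose_mat P = P"
    and "x \<in> carrier_vec n \<Longrightarrow> 0 \<le> x \<bullet> (P *\<^sub>v x)"
  using assms by (auto simp: psd_cone_def sym_mats_def)

lemma sym_matsD: "A \<in> sym_mats n \<Longrightarrow> A \<in> carrier_mat n n"
  by (simp add: sym_mats_def)

lemma sym_mats_arith:
  assumes "A \<in> sym_mats n" "B \<in> sym_mats n"
  shows "A + B \<in> sym_mats n" and "A - B \<in> sym_mats n" and "c \<cdot>\<^sub>m A \<in> sym_mats n"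
  using assms unfolding sym_mats_def
  by (auto simp: transpose_add transpose_minus intro!: eq_matI)
    (metis carrier_matD index_transpose_mat(1))

lemma one_sym_mats: "1\<^sub>m n \<in> sym_mats n"
  by (simp add: sym_mats_def)

lemma sym_mats_index:
  assumes "A \<in> sym_mats n" "i < n" "j < n"
  shows "A $$ (i, j) = A $$ (j, i)"
proof -
  have c: "A \<in> carrier_mat n n" and t: "transpose_mat A = A"
    using assms(1) by (auto simp: sym_mats_def)
  have "transpose_mat A $$ (i, j) = A $$ (j, i)"
    using c assms(2,3) by simp
  thus ?thesis unfolding t .
qed

lemma sym_form_commute:
  assumes A: "A \<in> sym_mats n" and x: "x \<in> carrier_vec n" and y: "y \<in> carrier_vec n"
  shows "x \<bullet> (A *\<^sub>v y) = y \<bullet> (A *\<^sub>v x)"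
proof -
  have c: "A \<in> carrier_mat n n" and t: "transpose_mat A = A"
    using A by (auto simp: sym_mats_def)
  have "x \<bullet> (A *\<^sub>v y) = (A *\<^sub>v x) \<bullet> y"
    using transpose_vec_mult_scalar[OF c y x] t by simp
  also have "\<dots> = y \<bullet> (A *\<^sub>v x)"
    by (rule comm_scalar_prod[of _ n]) (use c x y in auto)
  finally show ?thesis .
qed

lemma quadratic_form_expand:
  assumes A: "A \<in> sym_mats n" and x: "x \<in> carrier_vec n" and y: "y \<in> carrier_vec n"
  shows "(x + t \<cdot>\<^sub>v y) \<bullet> (A *\<^sub>v (x + t \<cdot>\<^sub>v y))
    = x \<bullet> (A *\<^sub>v x) + 2 * t * (x \<bullet> (A *\<^sub>v y)) + t\<^sup>2 * (y \<bullet> (A *\<^sub>v y))"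
proof -
  have c: "A \<in> carrier_mat n n" using A by (rule sym_matsD)
  have e: "A *\<^sub>v (x + t \<cdot>\<^sub>v y) = A *\<^sub>v x + t \<cdot>\<^sub>v (A *\<^sub>v y)"
    using c x y by (simp add: mult_add_distrib_mat_vec[of _ n n] mult_mat_vec[of _ n n])
  have "(x + t \<cdot>\<^sub>v y) \<bullet> (A *\<^sub>v x + t \<cdot>\<^sub>v (A *\<^sub>v y))
    = x \<bullet> (A *\<^sub>v x) + t * (x \<bullet> (A *\<^sub>v y)) + t * (y \<bullet> (A *\<^sub>v x)) + t * t * (y \<bullet> (A *\<^sub>v y))"
    using c x y
    by (simp add: add_scalar_prod_distrib[of _ n] scalar_prod_add_distrib[of _ n] algebra_simps)
  thus ?thesis unfolding e using sym_form_commute[OF A x y] by (simp add: power2_eq_square)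
qed

text \<open>Evaluate at the minimizer \<open>- b / c\<close>; if \<open>c = 0\<close>, an affine function bounded below is
  constant.\<close>

lemma discriminant_nonpos:
  fixes a b c :: real
  assumes nn: "\<And>t. 0 \<le> a + 2 * t * b + t\<^sup>2 * c" and c: "0 \<le> c"
  shows "b\<^sup>2 \<le> a * c"
proof (cases "c = 0")
  case True
  have "b = 0"
  proof (rule ccontr)
    assume "b \<noteq> 0"
    with nn[of "- (a + 1) / (2 * b)"] True show False by (simp add: field_simps)
  qed
  thus ?thesis using True by simp
next
  case False
  hence "c > 0" using c by simp
  have "0 \<le> a - b\<^sup>2 / c" using nn[of "- b / c"] \<open>c > 0\<close>
    by (simp add: power2_eq_square field_simps)
  thus ?thesis using \<open>c > 0\<close> by (simp add: field_simps)
qed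

lemma psd_Cauchy_Schwarz:
  assumes P: "P \<in> psd_cone n" and x: "x \<in> carrier_vec n" and y: "y \<in> carrier_vec n"
  shows "(x \<bullet> (P *\<^sub>v y))\<^sup>2 \<le> (x \<bullet> (P *\<^sub>v x)) * (y \<bullet> (P *\<^sub>v y))"
proof (rule discriminant_nonpos)
  fix t
  show "0 \<le> x \<bullet> (P *\<^sub>v x) + 2 * t * (x \<bullet> (P *\<^sub>v y)) + t\<^sup>2 * (y \<bullet> (P *\<^sub>v y))"
    using psd_coneD(4)[OF P, of "x + t \<cdot>\<^sub>v y"] quadratic_form_expand[OF psd_coneD(2)[OF P] x y, of t]
      x y by simp
qed (rule psd_coneD(4)[OF P y])

lemma scalar_self_ge_0: "0 \<le> (x :: real vec) \<bullet> x"
  by (auto simp: scalar_prod_def intro!: sum_nonneg)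

lemma one_psd: "1\<^sub>m n \<in> psd_cone n"
  by (auto simp: psd_cone_def one_sym_mats scalar_self_ge_0)

lemma vec_Cauchy_Schwarz:
  fixes x y :: "real vec"
  assumes "x \<in> carrier_vec n" "y \<in> carrier_vec n"
  shows "(x \<bullet> y)\<^sup>2 \<le> (x \<bullet> x) * (y \<bullet> y)"
  using psd_Cauchy_Schwarz[OF one_psd assms] assms by simp

lemma scalar_self_eq_0:
  fixes x :: "real vec"
  assumes "x \<in> carrier_vec n"
  shows "x \<bullet> x = 0 \<longleftrightarrow> x = 0\<^sub>v n"
  using assms conjugate_square_eq_0_vec[OF assms] by (simp add: conjugate_vec_def vec_eq_iff)

lemma vec_Cauchy_Schwarz_sqrt:
  fixes x y :: "real vec"
  assumes "x \<in> carrier_vec n" "y \<in> carrier_vec n"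
  shows "\<bar>x \<bullet> y\<bar> \<le> sqrt (x \<bullet> x) * sqrt (y \<bullet> y)"
  using real_sqrt_le_mono[OF vec_Cauchy_Schwarz[OF assms]] by (simp add: real_sqrt_mult)

text \<open>The bound is the squared Frobenius norm, increased by \<open>1\<close> to make it positive.\<close>

lemma mult_mat_vec_bounded:
  fixes A :: "real mat"
  assumes A: "A \<in> carrier_mat m n"
  obtains M where "M > 0" and "\<And>x. x \<in> carrier_vec n \<Longrightarrow> (A *\<^sub>v x) \<bullet> (A *\<^sub>v x) \<le> M * (x \<bullet> x)"
proof
  let ?M = "1 + (\<Sum>i<m. row A i \<bullet> row A i)"
  have nn: "0 \<le> (\<Sum>i<m. row A i \<bullet> row A i)"
    by (intro sum_nonneg scalar_self_ge_0)
  thus "?M > 0" by simp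
  fix x :: "real vec" assume x: "x \<in> carrier_vec n"
  have "(A *\<^sub>v x) \<bullet> (A *\<^sub>v x) = (\<Sum>i<m. (row A i \<bullet> x)\<^sup>2)"
    using A by (simp add: scalar_prod_def[of "A *\<^sub>v x"] power2_eq_square lessThan_atLeast0)
  also have "\<dots> \<le> (\<Sum>i<m. (row A i \<bullet> row A i) * (x \<bullet> x))"
    by (intro sum_mono vec_Cauchy_Schwarz[of _ n]) (use A x in auto)
  also have "\<dots> = (\<Sum>i<m. row A i \<bullet> row A i) * (x \<bullet> x)"
    by (rule sum_distrib_right[symmetric])
  also have "\<dots> \<le> ?M * (x \<bullet> x)"
    using scalar_self_ge_0[of x] by (simp add: algebra_simps)
  finally show "(A *\<^sub>v x) \<bullet> (A *\<^sub>v x) \<le> ?M * (x \<bullet> x)" .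
qed

text \<open>The form of a positive semidefinite matrix controls the matrix itself, because
  \<open>\<bar>Px\<bar>\<^sup>2\<close> is the value of the form at the pair \<open>(Px, x)\<close>, to which Cauchy-Schwarz applies.\<close>

lemma psd_form_controls_image:
  assumes P: "P \<in> psd_cone n"
  obtains M where "M > 0"
    and "\<And>x. x \<in> carrier_vec n \<Longrightarrow> (P *\<^sub>v x) \<bullet> (P *\<^sub>v x) \<le> M * (x \<bullet> (P *\<^sub>v x))"
proof -
  have c: "P \<in> carrier_mat n n" by (rule psd_coneD[OF P])
  obtain M where M: "M > 0" "\<And>x. x \<in> carrier_vec n \<Longrightarrow> (P *\<^sub>v x) \<bullet> (P *\<^sub>v x) \<le> M * (x \<bullet> x)"
    using mult_mat_vec_bounded[OF c] by blast
  have "(P *\<^sub>v x) \<bullet> (P *\<^sub>v x) \<le> (1 + M) * (x \<bullet> (P *\<^sub>v x))" if x: "x \<in> carrier_vec n" for x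
  proof -
    let ?y = "P *\<^sub>v x"
    let ?s = "?y \<bullet> ?y"
    have y: "?y \<in> carrier_vec n" using c x by simp
    have f0: "0 \<le> x \<bullet> ?y" by (rule psd_coneD(4)[OF P x])
    have s0: "0 \<le> ?s" by (rule scalar_self_ge_0)
    have py: "P *\<^sub>v ?y \<in> carrier_vec n" using c y by simp
    have "?y \<bullet> (P *\<^sub>v ?y) \<le> (1 + M) * ?s"
    proof -
      have "(?y \<bullet> (P *\<^sub>v ?y))\<^sup>2 \<le> ?s * ((P *\<^sub>v ?y) \<bullet> (P *\<^sub>v ?y))"
        by (rule vec_Cauchy_Schwarz[OF y py])
      also have "\<dots> \<le> ?s * (M * ?s)" by (intro mult_left_mono M(2)[OF y] s0)
      also have "?s * (M * ?s) = M * ?s\<^sup>2" by (simp add: power2_eq_square)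
      also have "\<dots> \<le> (1 + M)\<^sup>2 * ?s\<^sup>2"
        using M(1) by (intro mult_right_mono) (auto simp: power2_eq_square distrib_left distrib_right)
      also have "\<dots> = ((1 + M) * ?s)\<^sup>2" by (simp only: power_mult_distrib)
      finally show ?thesis by (rule power2_le_imp_le) (use M(1) s0 in simp)
    qed
    hence "(x \<bullet> ?y) * (?y \<bullet> (P *\<^sub>v ?y)) \<le> (x \<bullet> ?y) * ((1 + M) * ?s)"
      by (intro mult_left_mono f0)
    moreover have "?s\<^sup>2 \<le> (?y \<bullet> (P *\<^sub>v ?y)) * (x \<bullet> ?y)" by (rule psd_Cauchy_Schwarz[OF P y x])
    ultimately have "?s * ?s \<le> ((1 + M) * (x \<bullet> ?y)) * ?s"
      by (simp only: power2_eq_square mult_ac)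
    hence "?s \<le> (1 + M) * (x \<bullet> ?y)" if "?s \<noteq> 0"
      using s0 that by (simp only: mult_le_cancel_right)
    moreover have "0 \<le> (1 + M) * (x \<bullet> ?y)" using f0 M(1) by simp
    ultimately show ?thesis by fastforce
  qed
  thus ?thesis using that[of "1 + M"] M(1) by auto
qed

lemma psd_form_eq_0:
  assumes P: "P \<in> psd_cone n" and x: "x \<in> carrier_vec n" and 0: "x \<bullet> (P *\<^sub>v x) = 0"
  shows "P *\<^sub>v x = 0\<^sub>v n"
proof -
  have c: "P *\<^sub>v x \<in> carrier_vec n" using psd_coneD(1)[OF P] x by simp
  obtain M where "(P *\<^sub>v x) \<bullet> (P *\<^sub>v x) \<le> M * (x \<bullet> (P *\<^sub>v x))"
    using psd_form_controls_image[OF P] x by metis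
  thus ?thesis using 0 scalar_self_ge_0[of "P *\<^sub>v x"] scalar_self_eq_0[OF c] by simp
qed

lemma psd_cone_add:
  assumes P: "P \<in> psd_cone n" and Q: "Q \<in> psd_cone n"
  shows "P + Q \<in> psd_cone n"
proof -
  have "x \<bullet> ((P + Q) *\<^sub>v x) = x \<bullet> (P *\<^sub>v x) + x \<bullet> (Q *\<^sub>v x)" if "x \<in> carrier_vec n" for x
    using psd_coneD(1)[OF P] psd_coneD(1)[OF Q] that
    by (simp add: add_mult_distrib_mat_vec[of _ n n] scalar_prod_add_distrib[of _ n])
  thus ?thesis using assms sym_mats_arith(1)[OF psd_coneD(2)[OF P] psd_coneD(2)[OF Q]]
    by (simp add: psd_cone_def)
qed

lemma smult_mat_mult_vec:
  assumes "(A :: real mat) \<in> carrier_mat m n" "x \<in> carrier_vec n"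
  shows "(c \<cdot>\<^sub>m A) *\<^sub>v x = c \<cdot>\<^sub>v (A *\<^sub>v x)"
  using assms by (intro eq_vecI) auto

lemma psd_cone_smult:
  assumes P: "P \<in> psd_cone n" and c: "0 \<le> c"
  shows "c \<cdot>\<^sub>m P \<in> psd_cone n"
proof -
  have "x \<bullet> ((c \<cdot>\<^sub>m P) *\<^sub>v x) = c * (x \<bullet> (P *\<^sub>v x))" if "x \<in> carrier_vec n" for x
    using psd_coneD(1)[OF P] that by (simp add: smult_mat_mult_vec[of _ n n])
  thus ?thesis using assms sym_mats_arith(3)[OF psd_coneD(2)[OF P] psd_coneD(2)[OF P]]
    by (simp add: psd_cone_def)
qed

lemma zero_psd: "0\<^sub>m n n \<in> psd_cone n"
proof -
  have "(0\<^sub>m n n :: real mat) *\<^sub>v x = 0\<^sub>v n" if "x \<in> carrier_vec n" for x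
    using that by (intro eq_vecI) auto
  thus ?thesis by (auto simp: psd_cone_def sym_mats_def)
qed

lemma outer_square_carrier: "v \<in> carrier_vec n \<Longrightarrow> outer_square v \<in> carrier_mat n n"
  by (auto simp: outer_square_def)

lemma outer_square_mult_vec:
  assumes "v \<in> carrier_vec n" "x \<in> carrier_vec n"
  shows "outer_square v *\<^sub>v x = (v \<bullet> x) \<cdot>\<^sub>v v"
  using assms
  by (intro eq_vecI) (auto simp: outer_square_def scalar_prod_def sum_distrib_left algebra_simps intro!: sum.cong)

lemma outer_square_form:
  assumes "v \<in> carrier_vec n" "x \<in> carrier_vec n"
  shows "x \<bullet> (outer_square v *\<^sub>v x) = (v \<bullet> x)\<^sup>2"
  using assms comm_scalar_prod[of x n v]
  by (simp add: outer_square_mult_vec[OF assms] power2_eq_square)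

lemma outer_square_psd:
  assumes v: "v \<in> carrier_vec n"
  shows "outer_square v \<in> psd_cone n"
proof -
  have "outer_square v \<in> sym_mats n"
    using v by (auto simp: sym_mats_def outer_square_def mult.commute intro!: eq_matI)
  thus ?thesis using outer_square_form[OF v] by (simp add: psd_cone_def)
qed

section \<open>The trace inner product\<close>

lemma mat_trace_mult:
  assumes "A \<in> carrier_mat n m" "B \<in> carrier_mat m n"
  shows "mat_trace (A * B) = (\<Sum>i<n. \<Sum>j<m. A $$ (i, j) * B $$ (j, i))"
  using assms by (auto simp: mat_trace_def scalar_prod_def lessThan_atLeast0 intro!: sum.cong)

lemma mat_trace_mult_commute:
  assumes "A \<in> carrier_mat n m" "B \<in> carrier_mat m n"
  shows "mat_trace (A * B) = mat_trace (B * A)"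
  unfolding mat_trace_mult[OF assms] mat_trace_mult[OF assms(2,1)]
  by (subst sum.swap) (simp add: mult.commute)

lemma mat_trace_linear:
  assumes "A \<in> carrier_mat n n" "B \<in> carrier_mat n n"
  shows "mat_trace (A + B) = mat_trace A + mat_trace B"
    and "mat_trace (A - B) = mat_trace A - mat_trace B"
    and "mat_trace (c \<cdot>\<^sub>m A) = c * mat_trace A"
  using assms by (auto simp: mat_trace_def sum.distrib sum_subtractf sum_distrib_left)

lemma trace_inner_linear:
  assumes A: "A \<in> carrier_mat n n" and B: "B \<in> carrier_mat n n" and C: "C \<in> carrier_mat n n"
  shows "trace_inner (A + B) C = trace_inner A C + trace_inner B C"
    and "trace_inner (A - B) C = trace_inner A C - trace_inner B C"
    and "trace_inner (c \<cdot>\<^sub>m A) C = c * trace_inner A C"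
    and "trace_inner C (A + B) = trace_inner C A + trace_inner C B"
    and "trace_inner C (A - B) = trace_inner C A - trace_inner C B"
    and "trace_inner C (c \<cdot>\<^sub>m A) = c * trace_inner C A"
  using assms unfolding trace_inner_def
  by (simp_all add: add_mult_distrib_mat minus_mult_distrib_mat mult_add_distrib_mat
      mult_minus_distrib_mat mat_trace_linear[of _ n] mult_smult_assoc_mat[of _ n n]
      mult_smult_distrib[of _ n n])

lemma trace_inner_outer_square:
  assumes A: "A \<in> carrier_mat n n" and v: "v \<in> carrier_vec n"
  shows "trace_inner A (outer_square v) = v \<bullet> (A *\<^sub>v v)"
  unfolding trace_inner_def mat_trace_mult[OF A outer_square_carrier[OF v]]
  using assms
  by (auto simp: outer_square_def scalar_prod_def sum_distrib_left lessThan_atLeast0 algebra_simps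
      intro!: sum.cong)

lemma trace_outer_square: "v \<in> carrier_vec n \<Longrightarrow> mat_trace (outer_square v) = v \<bullet> v"
  by (auto simp: mat_trace_def outer_square_def scalar_prod_def lessThan_atLeast0)

lemma trace_inner_one: "A \<in> carrier_mat n n \<Longrightarrow> trace_inner (1\<^sub>m n) A = mat_trace A"
  by (simp add: trace_inner_def)

lemma trace_inner_self:
  assumes "A \<in> sym_mats n"
  shows "trace_inner A A = (\<Sum>i<n. \<Sum>j<n. (A $$ (i, j))\<^sup>2)"
proof -
  have "trace_inner A A = (\<Sum>i<n. \<Sum>j<n. A $$ (i, j) * A $$ (j, i))"
    unfolding trace_inner_def by (rule mat_trace_mult) (use assms in \<open>auto dest: sym_matsD\<close>)
  also have "\<dots> = (\<Sum>i<n. \<Sum>j<n. (A $$ (i, j))\<^sup>2)"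
    using sym_mats_index[OF assms] by (auto simp: power2_eq_square intro!: sum.cong)
  finally show ?thesis .
qed

lemma mult_mat_unit_vec:
  assumes "(A :: real mat) \<in> carrier_mat m n" "j < n"
  shows "A *\<^sub>v unit_vec n j = col A j"
  using assms by (intro eq_vecI) auto

lemma unit_vec_form:
  assumes "(P :: real mat) \<in> carrier_mat n n" "i < n"
  shows "unit_vec n i \<bullet> (P *\<^sub>v unit_vec n i) = P $$ (i, i)"
  using assms by (simp add: mult_mat_unit_vec[of _ n n])

lemma psd_trace_nonneg: "P \<in> psd_cone n \<Longrightarrow> 0 \<le> mat_trace P"
proof -
  assume P: "P \<in> psd_cone n"
  have "0 \<le> P $$ (i, i)" if "i < n" for i
    using psd_coneD(4)[OF P, of "unit_vec n i"] unit_vec_form[OF psd_coneD(1)[OF P] that] by simp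
  thus ?thesis using psd_coneD(1)[OF P] by (auto simp: mat_trace_def intro!: sum_nonneg)
qed

text \<open>One step of Cholesky elimination: subtracting the rank-one matrix \<open>P e\<^sub>k (P e\<^sub>k)\<^sup>T / P\<^sub>k\<^sub>k\<close>
  keeps the form nonnegative, by Cauchy-Schwarz for the form.\<close>

lemma psd_Cholesky_step:
  assumes P: "P \<in> psd_cone n" and k: "k < n" and pos: "P $$ (k, k) > 0"
  defines "w \<equiv> P *\<^sub>v unit_vec n k" and "c \<equiv> inverse (P $$ (k, k))"
  shows "P - c \<cdot>\<^sub>m outer_square w \<in> psd_cone n"
    and "j < n \<Longrightarrow> (P - c \<cdot>\<^sub>m outer_square w) *\<^sub>v unit_vec n j
      = P *\<^sub>v unit_vec n j - (c * P $$ (k, j)) \<cdot>\<^sub>v w"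
proof -
  let ?e = "unit_vec n k"
  have Pc: "P \<in> carrier_mat n n" and Ps: "P \<in> sym_mats n" by (rule psd_coneD[OF P])+
  have w: "w \<in> carrier_vec n" unfolding w_def using Pc by simp
  note ow = outer_square_carrier[OF w]
  have red: "(P - c \<cdot>\<^sub>m outer_square w) *\<^sub>v x = P *\<^sub>v x - (c * (w \<bullet> x)) \<cdot>\<^sub>v w"
    if x: "x \<in> carrier_vec n" for x
    using Pc ow w x
    by (simp add: minus_mult_distrib_mat_vec[of _ n n] smult_mat_mult_vec[of _ n n]
        outer_square_mult_vec smult_smult_assoc)
  have wx: "w \<bullet> x = x \<bullet> (P *\<^sub>v ?e)" if x: "x \<in> carrier_vec n" for x
    unfolding w_def by (rule comm_scalar_prod[of _ n]) (use Pc x in auto)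
  have "0 \<le> x \<bullet> ((P - c \<cdot>\<^sub>m outer_square w) *\<^sub>v x)" if x: "x \<in> carrier_vec n" for x
  proof -
    have "x \<bullet> ((P - c \<cdot>\<^sub>m outer_square w) *\<^sub>v x) = x \<bullet> (P *\<^sub>v x) - c * (w \<bullet> x)\<^sup>2"
      unfolding red[OF x] using Pc w x comm_scalar_prod[OF w x]
      by (simp add: scalar_prod_minus_distrib[of _ n] power2_eq_square)
    moreover have "(w \<bullet> x)\<^sup>2 \<le> (x \<bullet> (P *\<^sub>v x)) * P $$ (k, k)"
      using psd_Cauchy_Schwarz[OF P x unit_vec_carrier[of n k]] wx[OF x]
        unit_vec_form[OF Pc k] by simp
    ultimately show ?thesis using pos by (simp add: c_def pos_divide_le_eq flip: divide_inverse_commute)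
  qed
  moreover have "P - c \<cdot>\<^sub>m outer_square w \<in> sym_mats n"
    using psd_coneD(2)[OF P] psd_coneD(2)[OF outer_square_psd[OF w]] by (simp add: sym_mats_arith)
  ultimately show "P - c \<cdot>\<^sub>m outer_square w \<in> psd_cone n" by (simp add: psd_cone_def)
  assume j: "j < n"
  have "w \<bullet> unit_vec n j = P $$ (j, k)"
    using Pc w j k by (simp add: w_def mult_mat_unit_vec[of _ n n])
  thus "(P - c \<cdot>\<^sub>m outer_square w) *\<^sub>v unit_vec n j = P *\<^sub>v unit_vec n j - (c * P $$ (k, j)) \<cdot>\<^sub>v w"
    using red[of "unit_vec n j"] sym_mats_index[OF Ps j k] by simp
qed

text \<open>The cone is contained in its dual. Cholesky elimination writes \<open>P\<close> as a
  sum of matrices \<open>v v\<^sup>T\<close>, for which the trace product with \<open>A\<close> is \<open>v \<bullet> A v\<close>. The induction is on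
  the number of columns that are not yet eliminated.\<close>

lemma trace_inner_psd_nonneg:
  assumes A: "A \<in> psd_cone n" and P: "P \<in> psd_cone n"
  shows "0 \<le> trace_inner A P"
proof -
  have Ac: "A \<in> carrier_mat n n" by (rule psd_coneD[OF A])
  have "0 \<le> trace_inner A P"
    if "P \<in> psd_cone n" "k \<le> n" "\<And>j. j < k \<Longrightarrow> P *\<^sub>v unit_vec n j = 0\<^sub>v n" for P k
    using that(2,1,3)
  proof (induction k arbitrary: P rule: inc_induct)
    case base
    have Pc: "P \<in> carrier_mat n n" by (rule psd_coneD[OF base(1)])
    have "P $$ (i, j) = 0" if "i < n" "j < n" for i j
    proof -
      have "(P *\<^sub>v unit_vec n j) $ i = P $$ (i, j)" using Pc that by (simp add: mult_mat_unit_vec[of _ n n])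
      thus ?thesis using base(2)[OF that(2)] that by simp
    qed
    thus ?case using Ac Pc by (auto simp: trace_inner_def mat_trace_mult[of _ n n])
  next
    case (step k)
    have Pc: "P \<in> carrier_mat n n" by (rule psd_coneD[OF step.prems(1)])
    have k: "k < n" by fact
    have form: "unit_vec n k \<bullet> (P *\<^sub>v unit_vec n k) = P $$ (k, k)"
      by (rule unit_vec_form[OF Pc k])
    show ?case
    proof (cases "P $$ (k, k) = 0")
      case True
      have "P *\<^sub>v unit_vec n k = 0\<^sub>v n"
        by (rule psd_form_eq_0[OF step.prems(1)]) (use form True in auto)
      with step.prems(2) have "P *\<^sub>v unit_vec n j = 0\<^sub>v n" if "j < Suc k" for j
        using that by (cases "j = k") auto
      thus ?thesis by (intro step.IH step.prems(1))
    next
      case False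
      with psd_coneD(4)[OF step.prems(1), of "unit_vec n k"] form have pos: "P $$ (k, k) > 0" by simp
      define w where "w = P *\<^sub>v unit_vec n k"
      define c where "c = inverse (P $$ (k, k))"
      define P' where "P' = P - c \<cdot>\<^sub>m outer_square w"
      have w: "w \<in> carrier_vec n" unfolding w_def using Pc by simp
      note ow = outer_square_carrier[OF w]
      note chol = psd_Cholesky_step[OF step.prems(1) k pos, folded w_def c_def, folded P'_def]
      have "P' *\<^sub>v unit_vec n j = 0\<^sub>v n" if j: "j < Suc k" for j
      proof (cases "j = k")
        case True
        hence "P' *\<^sub>v unit_vec n j = w - 1 \<cdot>\<^sub>v w" using chol(2)[OF k] pos by (simp add: w_def c_def)
        thus ?thesis using w by simp
      next
        case False
        hence z: "P *\<^sub>v unit_vec n j = 0\<^sub>v n" using step.prems(2) j by simp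
        have "P $$ (k, j) = (P *\<^sub>v unit_vec n j) $ k"
          using Pc j k by (simp add: mult_mat_unit_vec[of _ n n])
        hence "P $$ (k, j) = 0" using z k by simp
        thus ?thesis using chol(2)[of j] z w j k by (auto intro!: eq_vecI)
      qed
      hence IH: "0 \<le> trace_inner A P'" by (intro step.IH chol(1))
      have "trace_inner A P' = trace_inner A P - c * (w \<bullet> (A *\<^sub>v w))"
        unfolding P'_def using Ac Pc ow w
        by (simp add: trace_inner_linear[of _ n] trace_inner_outer_square)
      moreover have "0 \<le> c * (w \<bullet> (A *\<^sub>v w))"
        using pos psd_coneD(4)[OF A w] by (simp add: c_def)
      ultimately show ?thesis using IH by simp
    qed
  qed
  from this[OF P, of 0] show ?thesis by simp
qed

section \<open>The nuclear norm, the operator norm and the distance to the cone\<close>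

text \<open>If \<open>B\<^sup>2 = P\<^sup>2\<close> and \<open>E = B - P\<close>, then \<open>tr (E B E) + tr (E P E) = tr ((B P - P B) E) = 0\<close>, and both
  summands are sums of values of nonnegative forms at the columns of \<open>E\<close>. Hence \<open>B E = P E = 0\<close> and
  \<open>E\<^sup>2 = 0\<close>.\<close>

lemma psd_square_root_unique:
  assumes B: "B \<in> psd_cone n" and P: "P \<in> psd_cone n" and eq: "B * B = P * P"
  shows "B = P"
proof -
  have Bc: "B \<in> carrier_mat n n" and Pc: "P \<in> carrier_mat n n"
    using psd_coneD(1)[OF B] psd_coneD(1)[OF P] by auto
  define E where "E = B - P"
  have Es: "E \<in> sym_mats n" unfolding E_def by (intro sym_mats_arith psd_coneD(2) B P)
  have Ec: "E \<in> carrier_mat n n" by (rule sym_matsD[OF Es])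
  have tr: "mat_trace (E * (C * E)) = (\<Sum>j<n. col E j \<bullet> (C *\<^sub>v col E j))" if C: "C \<in> carrier_mat n n" for C
  proof -
    have "(E * (C * E)) $$ (j, j) = col E j \<bullet> (C *\<^sub>v col E j)" if j: "j < n" for j
    proof -
      have "row E j = col E j"
        using j Ec sym_mats_index[OF Es] by (intro eq_vecI) auto
      moreover have "col (C * E) j = C *\<^sub>v col E j" using C Ec j by (intro eq_vecI) auto
      ultimately show ?thesis using Ec C j by simp
    qed
    thus ?thesis using Ec C by (simp add: mat_trace_def)
  qed
  have "mat_trace (E * (B * E)) + mat_trace (E * (P * E)) = 0"
  proof -
    have "mat_trace (E * (B * E)) = mat_trace (B * (E * E))" "mat_trace (E * (P * E)) = mat_trace (P * (E * E))"
      using mat_trace_mult_commute[of E n n "B * E"] mat_trace_mult_commute[of E n n "P * E"] Ec Bc Pc by auto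
    moreover have "E * E = B * B - P * B - (B * P - P * P)"
      unfolding E_def using Bc Pc
      by (simp add: minus_mult_distrib_mat[of _ n n] mult_minus_distrib_mat[of _ n n _ n] minus_carrier_mat)
    ultimately have "mat_trace (E * (B * E)) + mat_trace (E * (P * E))
      = mat_trace (B * (B * B)) - mat_trace (B * (B * P)) - mat_trace (B * (P * B)) + mat_trace (B * (P * P))
      + (mat_trace (P * (B * B)) - mat_trace (P * (B * P)) - mat_trace (P * (P * B)) + mat_trace (P * (P * P)))"
      using Bc Pc by (simp add: mult_minus_distrib_mat[of _ n n _ n] mat_trace_linear[of _ n] minus_carrier_mat)
    moreover have "mat_trace (B * (B * P)) = mat_trace (P * (B * B))"
      using mat_trace_mult_commute[of "B * B" n n P] Bc Pc by simp
    moreover have "mat_trace (B * (P * B)) = mat_trace (P * (B * B))"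
      using mat_trace_mult_commute[of B n n "P * B"] Bc Pc by simp
    moreover have "mat_trace (P * (P * B)) = mat_trace (B * (P * P))"
      using mat_trace_mult_commute[of "P * P" n n B] Bc Pc by simp
    moreover have "mat_trace (P * (B * P)) = mat_trace (B * (P * P))"
      using mat_trace_mult_commute[of P n n "B * P"] Bc Pc by simp
    moreover have "mat_trace (B * (B * B)) = mat_trace (B * (P * P))"
      "mat_trace (P * (B * B)) = mat_trace (P * (P * P))" using eq by auto
    ultimately show ?thesis by simp
  qed
  moreover have "0 \<le> mat_trace (E * (B * E))" "0 \<le> mat_trace (E * (P * E))"
    unfolding tr[OF Bc] tr[OF Pc] using psd_coneD(4)[OF B] psd_coneD(4)[OF P] Ec
    by (auto intro!: sum_nonneg)
  ultimately have z: "mat_trace (E * (B * E)) = 0" "mat_trace (E * (P * E)) = 0" by auto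
  have col0: "C *\<^sub>v col E j = 0\<^sub>v n" if C: "C \<in> psd_cone n" "mat_trace (E * (C * E)) = 0" and j: "j < n" for C j
  proof (rule psd_form_eq_0[OF C(1)])
    show ce: "col E j \<in> carrier_vec n" using Ec j by simp
    have "\<forall>j\<in>{..<n}. col E j \<bullet> (C *\<^sub>v col E j) = 0"
      using C(2) unfolding tr[OF psd_coneD(1)[OF C(1)]]
      by (subst (asm) sum_nonneg_eq_0_iff) (use psd_coneD(4)[OF C(1)] Ec in auto)
    thus "col E j \<bullet> (C *\<^sub>v col E j) = 0" using j by simp
  qed
  have "E $$ (i, j) = 0" if i: "i < n" and j: "j < n" for i j
  proof -
    have ce: "col E j \<in> carrier_vec n" using Ec j by simp
    have "E *\<^sub>v col E j = B *\<^sub>v col E j - P *\<^sub>v col E j"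
      using minus_mult_distrib_mat_vec[OF Bc Pc ce] by (simp only: E_def[symmetric])
    also have "\<dots> = 0\<^sub>v n" using col0[OF B z(1) j] col0[OF P z(2) j] by simp
    finally have "(E *\<^sub>v col E j) $ j = 0" using j by simp
    moreover have "row E j = col E j" using j Ec sym_mats_index[OF Es] by (intro eq_vecI) auto
    ultimately have "col E j \<bullet> col E j = 0" using Ec j by simp
    hence "col E j = 0\<^sub>v n" using scalar_self_eq_0[OF ce] by simp
    hence "col E j $ i = 0" using i by simp
    thus ?thesis using Ec i j by simp
  qed
  thus ?thesis using Bc Pc unfolding E_def by (intro eq_matI) auto
qed

lemma nuclear_norm_psd:
  assumes P: "P \<in> psd_cone n"
  shows "nuclear_norm P = mat_trace P"
proof -
  have "mat_abs P = P"
    unfolding mat_abs_def using psd_coneD(1,3)[OF P] P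
    by (intro the_equality) (auto intro: psd_square_root_unique)
  thus ?thesis by (simp add: nuclear_norm_def)
qed

lemma op_norm_bdd_above:
  assumes "A \<in> carrier_mat n n"
  shows "bdd_above ((\<lambda>x. sqrt ((A *\<^sub>v x) \<bullet> (A *\<^sub>v x))) ` {x \<in> carrier_vec (dim_col A). x \<bullet> x \<le> 1})"
proof -
  obtain M where M: "M > 0" "\<And>x. x \<in> carrier_vec n \<Longrightarrow> (A *\<^sub>v x) \<bullet> (A *\<^sub>v x) \<le> M * (x \<bullet> x)"
    using mult_mat_vec_bounded[OF assms] by blast
  have "(A *\<^sub>v x) \<bullet> (A *\<^sub>v x) \<le> M" if "x \<in> carrier_vec n" "x \<bullet> x \<le> 1" for x
  proof -
    have "M * (x \<bullet> x) \<le> M * 1" using M(1) that(2) by (intro mult_left_mono) auto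
    thus ?thesis using M(2)[OF that(1)] by simp
  qed
  thus ?thesis using assms by (intro bdd_aboveI[of _ "sqrt M"]) auto
qed

lemma op_norm_upper:
  assumes A: "A \<in> carrier_mat n n" and x: "x \<in> carrier_vec n" "x \<bullet> x \<le> 1"
  shows "sqrt ((A *\<^sub>v x) \<bullet> (A *\<^sub>v x)) \<le> op_norm A"
  unfolding op_norm_def by (rule cSUP_upper[OF _ op_norm_bdd_above[OF A]]) (use A x in auto)

lemma op_norm_nonneg: "A \<in> carrier_mat n n \<Longrightarrow> 0 \<le> op_norm A"
  using op_norm_upper[of A n "0\<^sub>v n"] by (auto simp: scalar_self_ge_0 intro: order_trans[rotated])

lemma op_norm_form_upper:
  assumes A: "A \<in> carrier_mat n n" and x: "x \<in> carrier_vec n"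
  shows "x \<bullet> (A *\<^sub>v x) \<le> op_norm A * (x \<bullet> x)"
proof (cases "x \<bullet> x = 0")
  case True
  thus ?thesis using scalar_self_eq_0[OF x] A by simp
next
  case False
  define s where "s = sqrt (x \<bullet> x)"
  have s: "s > 0" "s\<^sup>2 = x \<bullet> x" using False scalar_self_ge_0[of x] by (auto simp: s_def)
  define u where "u = inverse s \<cdot>\<^sub>v x"
  have u: "u \<in> carrier_vec n" using x by (simp add: u_def)
  have "u \<bullet> u = (x \<bullet> x) / s\<^sup>2" unfolding u_def using x s(1) by (simp add: power2_eq_square field_simps)
  hence uu: "u \<bullet> u = 1" using s False by simp
  have Au: "A *\<^sub>v u \<in> carrier_vec n" using A u by simp
  have "u \<bullet> (A *\<^sub>v u) \<le> sqrt ((A *\<^sub>v u) \<bullet> (A *\<^sub>v u))"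
    using vec_Cauchy_Schwarz_sqrt[OF u Au] uu by simp
  also have "\<dots> \<le> op_norm A" by (rule op_norm_upper[OF A u]) (simp add: uu)
  finally have "u \<bullet> (A *\<^sub>v u) \<le> op_norm A" .
  moreover have "u \<bullet> (A *\<^sub>v u) = (x \<bullet> (A *\<^sub>v x)) / s\<^sup>2"
    unfolding u_def using A x s
    by (simp add: mult_mat_vec[of _ n n] power2_eq_square field_simps)
  ultimately have "(x \<bullet> (A *\<^sub>v x)) / s\<^sup>2 \<le> op_norm A" by simp
  moreover have "s\<^sup>2 > 0" using s(1) by simp
  ultimately show ?thesis by (simp add: s(2)[symmetric] pos_divide_le_eq)
qed

text \<open>The duality of the operator norm and the nuclear norm, which is the trace on the cone: the matrix
  \<open>\<parallel>A\<parallel> I - A\<close> lies in the cone, so its trace product with \<open>P\<close> is nonnegative.\<close>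

lemma trace_inner_le_op_norm:
  assumes A: "A \<in> sym_mats n" and P: "P \<in> psd_cone n"
  shows "trace_inner A P \<le> op_norm A * mat_trace P"
proof -
  have Ac: "A \<in> carrier_mat n n" and Pc: "P \<in> carrier_mat n n"
    using sym_matsD[OF A] psd_coneD(1)[OF P] by auto
  have "op_norm A \<cdot>\<^sub>m 1\<^sub>m n - A \<in> psd_cone n"
    unfolding psd_cone_def using sym_mats_arith[OF sym_mats_arith(3)[OF one_sym_mats one_sym_mats] A]
      op_norm_form_upper[OF Ac] Ac
    by (auto simp: minus_mult_distrib_mat_vec[of _ n n] smult_mat_mult_vec[of _ n n]
        scalar_prod_minus_distrib[of _ n])
  from trace_inner_psd_nonneg[OF this P] show ?thesis
    using Ac Pc by (simp add: trace_inner_linear[of _ n] trace_inner_one)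
qed

lemma finite_eigenvalues:
  assumes A: "(A :: real mat) \<in> carrier_mat n n"
  shows "finite {l. eigenvalue A l}"
proof -
  have "coeff (char_poly A) n = 1" using degree_monic_char_poly[OF A] by simp
  hence "char_poly A \<noteq> 0" by auto
  thus ?thesis using poly_roots_finite eigenvalue_root_char_poly[OF A] by simp
qed

text \<open>The infimum \<open>\<mu>\<close> of the Rayleigh quotient is an eigenvalue: otherwise \<open>A - \<mu> I\<close> has an inverse,
  its form is bounded below by a positive multiple of \<open>x \<bullet> x\<close>, and \<open>\<mu>\<close> is not the infimum. Hence
  the smallest eigenvalue is at most \<open>\<mu>\<close>. This determinant argument takes the place of attaining the
  infimum by compactness of the sphere.\<close>

lemma lambda_min_le_form:
  assumes A: "A \<in> sym_mats n" and x: "x \<in> carrier_vec n"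
  shows "lambda_min A * (x \<bullet> x) \<le> x \<bullet> (A *\<^sub>v x)"
proof (cases "x = 0\<^sub>v n")
  case True
  thus ?thesis using sym_matsD[OF A] by simp
next
  case False
  have Ac: "A \<in> carrier_mat n n" by (rule sym_matsD[OF A])
  define S where "S = {v \<in> carrier_vec n. v \<bullet> v = (1::real)}"
  define \<mu> where "\<mu> = (INF v\<in>S. v \<bullet> (A *\<^sub>v v))"
  have normalize: "\<exists>s>0. inverse s \<cdot>\<^sub>v v \<in> S \<and> s\<^sup>2 = v \<bullet> v"
    if v: "v \<in> carrier_vec n" "v \<noteq> 0\<^sub>v n" for v
  proof -
    have "v \<bullet> v > 0" using scalar_self_ge_0[of v] scalar_self_eq_0[OF v(1)] v(2) by linarith
    thus ?thesis using v(1)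
      by (intro exI[of _ "sqrt (v \<bullet> v)"]) (auto simp: S_def field_simps)
  qed
  have form_scale: "(c \<cdot>\<^sub>v v) \<bullet> (A *\<^sub>v (c \<cdot>\<^sub>v v)) = c\<^sup>2 * (v \<bullet> (A *\<^sub>v v))" if "v \<in> carrier_vec n" for c v
    using Ac that by (simp add: mult_mat_vec[of _ n n] power2_eq_square)
  have S: "S \<noteq> {}" using normalize[OF x False] by auto
  have bdd: "bdd_below ((\<lambda>v. v \<bullet> (A *\<^sub>v v)) ` S)"
  proof (rule bdd_belowI)
    fix t assume "t \<in> (\<lambda>v. v \<bullet> (A *\<^sub>v v)) ` S"
    then obtain v where v: "v \<in> carrier_vec n" "v \<bullet> v = 1" "t = v \<bullet> (A *\<^sub>v v)" by (auto simp: S_def)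
    have "\<bar>t\<bar> \<le> sqrt ((A *\<^sub>v v) \<bullet> (A *\<^sub>v v))"
      using vec_Cauchy_Schwarz_sqrt[of v n "A *\<^sub>v v"] v Ac by simp
    also have "\<dots> \<le> op_norm A" by (rule op_norm_upper[OF Ac v(1)]) (simp add: v)
    finally show "- op_norm A \<le> t" by simp
  qed
  have mu_le: "\<mu> * (v \<bullet> v) \<le> v \<bullet> (A *\<^sub>v v)" if v: "v \<in> carrier_vec n" for v
  proof (cases "v = 0\<^sub>v n")
    case True
    thus ?thesis using Ac by simp
  next
    case False
    then obtain s where s: "s > 0" "inverse s \<cdot>\<^sub>v v \<in> S" "s\<^sup>2 = v \<bullet> v" using normalize v by blast
    have "\<mu> \<le> (inverse s)\<^sup>2 * (v \<bullet> (A *\<^sub>v v))"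
      unfolding \<mu>_def form_scale[OF v, symmetric] by (rule cINF_lower[OF bdd s(2)])
    hence "\<mu> \<le> (v \<bullet> (A *\<^sub>v v)) / s\<^sup>2" by (simp add: power_inverse divide_inverse mult.commute)
    moreover have "s\<^sup>2 > 0" using s(1) by simp
    ultimately show ?thesis by (simp add: s(3)[symmetric] pos_le_divide_eq)
  qed
  define B where "B = A - \<mu> \<cdot>\<^sub>m 1\<^sub>m n"
  have Bc: "B \<in> carrier_mat n n" unfolding B_def using Ac by auto
  have Bv: "B *\<^sub>v v = A *\<^sub>v v - \<mu> \<cdot>\<^sub>v v" if "v \<in> carrier_vec n" for v
    unfolding B_def using Ac that
    by (simp add: minus_mult_distrib_mat_vec[of _ n n] smult_mat_mult_vec[of _ n n])
  have Bform: "v \<bullet> (B *\<^sub>v v) = v \<bullet> (A *\<^sub>v v) - \<mu> * (v \<bullet> v)" if "v \<in> carrier_vec n" for v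
    unfolding Bv[OF that] using Ac that by (simp add: scalar_prod_minus_distrib[of _ n])
  have Bpsd: "B \<in> psd_cone n"
    unfolding psd_cone_def
    using sym_mats_arith(2)[OF A sym_mats_arith(3)[OF one_sym_mats one_sym_mats], of \<mu>] mu_le Bform
    by (auto simp: B_def)
  have "det B = 0"
  proof (rule ccontr)
    assume "det B \<noteq> 0"
    from det_non_zero_imp_unit[OF Bc this] obtain C where C: "C \<in> carrier_mat n n" "C * B = 1\<^sub>m n"
      unfolding Units_def by (auto simp: ring_mat_simps)
    obtain M where M: "M > 0" "\<And>v. v \<in> carrier_vec n \<Longrightarrow> (B *\<^sub>v v) \<bullet> (B *\<^sub>v v) \<le> M * (v \<bullet> (B *\<^sub>v v))"
      using psd_form_controls_image[OF Bpsd] by blast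
    obtain K where K: "K > 0" "\<And>v. v \<in> carrier_vec n \<Longrightarrow> (C *\<^sub>v v) \<bullet> (C *\<^sub>v v) \<le> K * (v \<bullet> v)"
      using mult_mat_vec_bounded[OF C(1)] by blast
    (* K bounds the inverse of B and M the image of B by its form, so the form of B is at least
       1 / (K M) on the unit sphere. *)
    have "\<mu> + 1 / (K * M) \<le> v \<bullet> (A *\<^sub>v v)" if "v \<in> S" for v
    proof -
      have v: "v \<in> carrier_vec n" "v \<bullet> v = 1" using that by (auto simp: S_def)
      have "v = C *\<^sub>v (B *\<^sub>v v)"
        using assoc_mult_mat_vec[OF C(1) Bc v(1)] C(2) v(1) by simp
      hence "1 = (C *\<^sub>v (B *\<^sub>v v)) \<bullet> (C *\<^sub>v (B *\<^sub>v v))" using v(2) by simp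
      also have "\<dots> \<le> K * ((B *\<^sub>v v) \<bullet> (B *\<^sub>v v))" by (rule K(2)) (use Bc v in simp)
      also have "\<dots> \<le> K * (M * (v \<bullet> (B *\<^sub>v v)))" using M(2)[OF v(1)] K(1) by simp
      also have "\<dots> = K * M * (v \<bullet> (A *\<^sub>v v) - \<mu>)" using Bform[OF v(1)] v(2) by simp
      finally show ?thesis using K(1) M(1) by (simp add: field_simps)
    qed
    hence "\<mu> + 1 / (K * M) \<le> \<mu>" unfolding \<mu>_def by (intro cINF_greatest S) (auto simp: \<mu>_def)
    thus False using K(1) M(1) by (simp add: field_simps)
  qed
  then obtain v where v: "v \<in> carrier_vec n" "v \<noteq> 0\<^sub>v n" "B *\<^sub>v v = 0\<^sub>v n"
    using det_0_iff_vec_prod_zero[OF Bc] by blast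
  have "A *\<^sub>v v = \<mu> \<cdot>\<^sub>v v"
  proof (rule eq_vecI)
    fix i assume "i < dim_vec (\<mu> \<cdot>\<^sub>v v)"
    hence "i < n" using v by simp
    thus "(A *\<^sub>v v) $ i = (\<mu> \<cdot>\<^sub>v v) $ i"
      using arg_cong[OF v(3)[unfolded Bv[OF v(1)]], of "\<lambda>w. w $ i"] v(1) Ac by simp
  qed (use Ac v in auto)
  hence "eigenvalue A \<mu>" unfolding eigenvalue_def eigenvector_def using v Ac by auto
  hence "lambda_min A \<le> \<mu>" unfolding lambda_min_def by (intro Min_le finite_eigenvalues[OF Ac]) auto
  hence "lambda_min A * (x \<bullet> x) \<le> \<mu> * (x \<bullet> x)" by (intro mult_right_mono scalar_self_ge_0)
  thus ?thesis using mu_le[OF x] by simp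
qed

text \<open>This shifted matrix serves twice: as the point of the cone that bounds the distance of \<open>A\<close>, and as
  a test matrix that bounds \<open>tr (A P)\<close> below.\<close>

lemma shift_lambda_min_psd:
  assumes A: "A \<in> sym_mats n"
  shows "A + max 0 (- lambda_min A) \<cdot>\<^sub>m 1\<^sub>m n \<in> psd_cone n"
proof -
  have Ac: "A \<in> carrier_mat n n" by (rule sym_matsD[OF A])
  let ?m = "max 0 (- lambda_min A)"
  have "0 \<le> x \<bullet> ((A + ?m \<cdot>\<^sub>m 1\<^sub>m n) *\<^sub>v x)" if x: "x \<in> carrier_vec n" for x
  proof -
    have "x \<bullet> ((A + ?m \<cdot>\<^sub>m 1\<^sub>m n) *\<^sub>v x) = x \<bullet> (A *\<^sub>v x) + ?m * (x \<bullet> x)"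
      using Ac x by (simp add: add_mult_distrib_mat_vec[of _ n n] smult_mat_mult_vec[of _ n n]
        scalar_prod_add_distrib[of _ n])
    moreover have "- lambda_min A * (x \<bullet> x) \<le> ?m * (x \<bullet> x)"
      by (intro mult_right_mono scalar_self_ge_0) simp
    ultimately show ?thesis using lambda_min_le_form[OF A x] by simp
  qed
  thus ?thesis using sym_mats_arith(1)[OF A sym_mats_arith(3)[OF one_sym_mats one_sym_mats]]
    by (simp add: psd_cone_def)
qed

lemma trace_inner_ge_lambda_min:
  assumes A: "A \<in> sym_mats n" and P: "P \<in> psd_cone n"
  shows "- max 0 (- lambda_min A) * mat_trace P \<le> trace_inner A P"
  using trace_inner_psd_nonneg[OF shift_lambda_min_psd[OF A] P] sym_matsD[OF A] psd_coneD(1)[OF P]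
  by (simp add: trace_inner_linear[of _ n] trace_inner_one)

lemma dist_op_psd_le:
  assumes A: "A \<in> sym_mats n"
  shows "0 \<le> dist_op A (psd_cone n)" and "dist_op A (psd_cone n) \<le> max 0 (- lambda_min A)"
proof -
  have Ac: "A \<in> carrier_mat n n" by (rule sym_matsD[OF A])
  let ?m = "max 0 (- lambda_min A)"
  let ?P = "A + ?m \<cdot>\<^sub>m 1\<^sub>m n"
  have nn: "0 \<le> op_norm (A - P)" if "P \<in> psd_cone n" for P
    by (rule op_norm_nonneg[of _ n]) (use Ac psd_coneD(1)[OF that] in auto)
  show "0 \<le> dist_op A (psd_cone n)"
    unfolding dist_op_def using zero_psd nn by (intro cINF_greatest) auto
  have "dist_op A (psd_cone n) \<le> op_norm (A - ?P)"
    unfolding dist_op_def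
    by (rule cINF_lower[OF _ shift_lambda_min_psd[OF A]]) (use nn in \<open>auto intro!: bdd_belowI[of _ 0]\<close>)
  also have "A - ?P = (- ?m) \<cdot>\<^sub>m 1\<^sub>m n" using Ac by (intro eq_matI) auto
  also have "op_norm \<dots> \<le> ?m"
    unfolding op_norm_def
  proof (rule cSUP_least)
    show "{x \<in> carrier_vec (dim_col (- ?m \<cdot>\<^sub>m 1\<^sub>m n)). x \<bullet> x \<le> (1 :: real)} \<noteq> {}"
      by (auto intro!: exI[of _ "0\<^sub>v n"])
    fix x :: "real vec" assume "x \<in> {x \<in> carrier_vec (dim_col (- ?m \<cdot>\<^sub>m 1\<^sub>m n)). x \<bullet> x \<le> 1}"
    hence x: "x \<in> carrier_vec n" "x \<bullet> x \<le> 1" by auto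
    have "(- ?m \<cdot>\<^sub>m 1\<^sub>m n) *\<^sub>v x = (- ?m) \<cdot>\<^sub>v x" using x by (simp add: smult_mat_mult_vec[of _ n n])
    hence "sqrt (((- ?m \<cdot>\<^sub>m 1\<^sub>m n) *\<^sub>v x) \<bullet> ((- ?m \<cdot>\<^sub>m 1\<^sub>m n) *\<^sub>v x)) = ?m * sqrt (x \<bullet> x)"
      using x by (simp add: real_sqrt_mult flip: mult.assoc)
    also have "\<dots> \<le> ?m * 1" using x by (intro mult_left_mono) auto
    finally show "sqrt (((- ?m \<cdot>\<^sub>m 1\<^sub>m n) *\<^sub>v x) \<bullet> ((- ?m \<cdot>\<^sub>m 1\<^sub>m n) *\<^sub>v x)) \<le> ?m" by simp
  qed
  finally show "dist_op A (psd_cone n) \<le> ?m" .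
qed

section \<open>Norming functionals in finite dimension\<close>

definition sublinear :: "nat \<Rightarrow> (real vec \<Rightarrow> real) \<Rightarrow> bool" where
  "sublinear d p \<longleftrightarrow>
     (\<forall>x \<in> carrier_vec d. \<forall>y \<in> carrier_vec d. p (x + y) \<le> p x + p y) \<and>
     (\<forall>c\<ge>0. \<forall>x \<in> carrier_vec d. p (c \<cdot>\<^sub>v x) = c * p x)"

lemma sublinearD:
  assumes "sublinear d p" "x \<in> carrier_vec d"
  shows "y \<in> carrier_vec d \<Longrightarrow> p (x + y) \<le> p x + p y"
    and "0 \<le> c \<Longrightarrow> p (c \<cdot>\<^sub>v x) = c * p x"
  using assms by (auto simp: sublinear_def)

lemma sublinear_zero: "sublinear d p \<Longrightarrow> p (0\<^sub>v d) = 0"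
proof -
  assume p: "sublinear d p"
  have "0 \<cdot>\<^sub>v (0\<^sub>v d :: real vec) = 0\<^sub>v d" by (auto intro!: eq_vecI)
  thus ?thesis using sublinearD(2)[OF p, of "0\<^sub>v d" 0] by simp
qed

text \<open>The Hahn-Banach step, formulated for functionals on the whole space instead of extensions from
  subspaces: the infimum over a direction \<open>v\<close> makes a sublinear functional linear in that direction.
  Repeating the step for all coordinate directions yields a linear functional.\<close>

lemma sublinear_direction_step:
  assumes p: "sublinear d p" and v: "v \<in> carrier_vec d"
  obtains p' where "sublinear d p'" and "\<And>x. x \<in> carrier_vec d \<Longrightarrow> p' x \<le> p x"
    and "p' (- v) \<le> - p v"
proof -
  define F where "F x s = p (x + s \<cdot>\<^sub>v v) - s * p v" for x s
  define p' where "p' x = (INF s\<in>{0..}. F x s)" for x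
  (* The infimum is finite, since s * p v = p (s v) and s v is the sum of x + s v and - x. *)
  have below: "- p (- x) \<le> F x s" if x: "x \<in> carrier_vec d" and s: "0 \<le> s" for x s
  proof -
    have "(x + s \<cdot>\<^sub>v v) + - x = s \<cdot>\<^sub>v v" using x v by (intro eq_vecI) auto
    hence "s * p v = p ((x + s \<cdot>\<^sub>v v) + - x)" using sublinearD(2)[OF p v s] by simp
    also have "\<dots> \<le> p (x + s \<cdot>\<^sub>v v) + p (- x)" by (rule sublinearD(1)[OF p]) (use x v in auto)
    finally show ?thesis by (simp add: F_def)
  qed
  have bdd: "bdd_below (F x ` {0..})" if "x \<in> carrier_vec d" for x
    using below[OF that] by (intro bdd_belowI[of _ "- p (- x)"]) auto
  have lower: "p' x \<le> F x s" if "x \<in> carrier_vec d" "0 \<le> s" for x s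
    unfolding p'_def by (rule cINF_lower[OF bdd]) (use that in auto)
  have greatest: "c \<le> p' x" if "\<And>s. 0 \<le> s \<Longrightarrow> c \<le> F x s" for c x
    unfolding p'_def by (rule cINF_greatest) (use that in auto)
  have add: "p' (x + y) \<le> p' x + p' y" if x: "x \<in> carrier_vec d" and y: "y \<in> carrier_vec d" for x y
  proof -
    have st: "p' (x + y) \<le> F x s + F y t" if s: "0 \<le> s" and t: "0 \<le> t" for s t
    proof -
      have "(x + y) + (s + t) \<cdot>\<^sub>v v = (x + s \<cdot>\<^sub>v v) + (y + t \<cdot>\<^sub>v v)"
        using x y v by (intro eq_vecI) (auto simp: distrib_right)
      hence "F (x + y) (s + t) = p ((x + s \<cdot>\<^sub>v v) + (y + t \<cdot>\<^sub>v v)) - (s + t) * p v"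
        by (simp add: F_def)
      moreover have "p' (x + y) \<le> F (x + y) (s + t)" by (rule lower) (use x y s t in auto)
      ultimately have "p' (x + y) \<le> p ((x + s \<cdot>\<^sub>v v) + (y + t \<cdot>\<^sub>v v)) - (s + t) * p v" by simp
      also have "\<dots> \<le> p (x + s \<cdot>\<^sub>v v) + p (y + t \<cdot>\<^sub>v v) - (s + t) * p v"
        using sublinearD(1)[OF p, of "x + s \<cdot>\<^sub>v v" "y + t \<cdot>\<^sub>v v"] x y v by simp
      finally show ?thesis by (simp add: F_def distrib_right)
    qed
    have "p' (x + y) - F y t \<le> p' x" if "0 \<le> t" for t
      using st[OF _ that] by (intro greatest) (simp add: algebra_simps)
    hence "p' (x + y) - p' x \<le> F y t" if "0 \<le> t" for t
      using that by (simp add: algebra_simps)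
    hence "p' (x + y) - p' x \<le> p' y" by (rule greatest)
    thus ?thesis by simp
  qed
  have scale_le: "p' (c \<cdot>\<^sub>v x) \<le> c * p' x" if x: "x \<in> carrier_vec d" and c: "c > 0" for c x
  proof -
    have "p' (c \<cdot>\<^sub>v x) / c \<le> F x s" if s: "0 \<le> s" for s
    proof -
      have "c \<cdot>\<^sub>v x + (c * s) \<cdot>\<^sub>v v = c \<cdot>\<^sub>v (x + s \<cdot>\<^sub>v v)"
        using x v by (intro eq_vecI) (auto simp: distrib_left)
      hence "F (c \<cdot>\<^sub>v x) (c * s) = p (c \<cdot>\<^sub>v (x + s \<cdot>\<^sub>v v)) - c * s * p v"
        by (simp add: F_def)
      moreover have "p' (c \<cdot>\<^sub>v x) \<le> F (c \<cdot>\<^sub>v x) (c * s)" by (rule lower) (use x c s in auto)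
      ultimately have "p' (c \<cdot>\<^sub>v x) \<le> p (c \<cdot>\<^sub>v (x + s \<cdot>\<^sub>v v)) - c * s * p v" by simp
      also have "\<dots> = c * F x s"
        using sublinearD(2)[OF p, of "x + s \<cdot>\<^sub>v v" c] x v c by (simp add: F_def right_diff_distrib)
      finally show ?thesis using c by (simp add: field_simps)
    qed
    hence "p' (c \<cdot>\<^sub>v x) / c \<le> p' x" by (rule greatest)
    thus ?thesis using c by (simp add: field_simps)
  qed
  have scale: "p' (c \<cdot>\<^sub>v x) = c * p' x" if x: "x \<in> carrier_vec d" and c: "0 \<le> c" for c x
  proof (cases "c = 0")
    case True
    have "F (0\<^sub>v d) s = 0" if "0 \<le> s" for s
      using sublinearD(2)[OF p v that] v by (simp add: F_def)
    hence "p' (0\<^sub>v d) = 0" unfolding p'_def by (subst INF_cong[OF refl, of _ _ "\<lambda>_. 0"]) auto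
    moreover have "c \<cdot>\<^sub>v x = 0\<^sub>v d" using x True by (auto intro!: eq_vecI)
    ultimately show ?thesis using True by simp
  next
    case False
    hence c0: "c > 0" using c by simp
    have "p' x = p' (inverse c \<cdot>\<^sub>v (c \<cdot>\<^sub>v x))" using c0 by (simp add: smult_smult_assoc)
    also have "\<dots> \<le> inverse c * p' (c \<cdot>\<^sub>v x)" by (rule scale_le) (use x c0 in auto)
    finally have "c * p' x \<le> p' (c \<cdot>\<^sub>v x)" using c0 by (simp add: field_simps)
    with scale_le[OF x c0] show ?thesis by simp
  qed
  have "p' x \<le> p x" if "x \<in> carrier_vec d" for x
  proof -
    have "x + 0 \<cdot>\<^sub>v v = x" using that v by (auto intro!: eq_vecI)
    thus ?thesis using lower[OF that, of 0] by (simp add: F_def)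
  qed
  moreover have "p' (- v) \<le> - p v"
    using lower[of "- v" 1] v sublinear_zero[OF p] by (simp add: F_def)
  ultimately show ?thesis using that[of p'] add scale by (auto simp: sublinear_def)
qed

lemma sublinear_directions:
  assumes "sublinear d p" and "set vs \<subseteq> carrier_vec d"
  shows "\<exists>p'. sublinear d p' \<and> (\<forall>x \<in> carrier_vec d. p' x \<le> p x) \<and> (\<forall>v \<in> set vs. p' (- v) \<le> - p' v)"
  using assms
proof (induction vs arbitrary: p)
  case Nil
  thus ?case by auto
next
  case (Cons v vs)
  have v: "v \<in> carrier_vec d" using Cons.prems(2) by simp
  obtain p1 where p1: "sublinear d p1" "\<And>x. x \<in> carrier_vec d \<Longrightarrow> p1 x \<le> p x" "p1 (- v) \<le> - p v"
    using sublinear_direction_step[OF Cons.prems(1) v] by blast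
  obtain p2 where p2: "sublinear d p2" "\<And>x. x \<in> carrier_vec d \<Longrightarrow> p2 x \<le> p1 x"
    "\<And>u. u \<in> set vs \<Longrightarrow> p2 (- u) \<le> - p2 u"
    using Cons.IH[OF p1(1)] Cons.prems(2) by auto
  have "p2 (- v) \<le> - p2 v"
    using p2(2)[of "- v"] p1(3) p2(2)[OF v] p1(2)[OF v] v by simp
  moreover have "p2 x \<le> p x" if "x \<in> carrier_vec d" for x
    using p1(2)[OF that] p2(2)[OF that] by simp
  ultimately show ?case using p2 by (intro exI[of _ p2]) auto
qed

text \<open>The supporting functional at \<open>w\<close> arises by treating the direction \<open>w\<close> first, which fixes the
  value at \<open>- w\<close>, and then the unit vectors.\<close>

theorem sublinear_support:
  assumes p: "sublinear d p" and w: "w \<in> carrier_vec d"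
  obtains a where "a \<in> carrier_vec d" and "a \<bullet> w = p w"
    and "\<And>x. x \<in> carrier_vec d \<Longrightarrow> a \<bullet> x \<le> p x"
proof -
  obtain p1 where p1: "sublinear d p1" "\<And>x. x \<in> carrier_vec d \<Longrightarrow> p1 x \<le> p x" "p1 (- w) \<le> - p w"
    using sublinear_direction_step[OF p w] by blast
  have "set (map (unit_vec d) [0..<d]) \<subseteq> carrier_vec d" by auto
  from sublinear_directions[OF p1(1) this] obtain p2
    where p2: "sublinear d p2" "\<And>x. x \<in> carrier_vec d \<Longrightarrow> p2 x \<le> p1 x"
      and unit: "\<And>i. i < d \<Longrightarrow> p2 (- unit_vec d i) \<le> - p2 (unit_vec d i)"
    by auto
  define a where "a = vec d (\<lambda>i. p2 (unit_vec d i))"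
  have a: "a \<in> carrier_vec d" by (simp add: a_def)
  have coord: "p2 (c \<cdot>\<^sub>v unit_vec d i) \<le> c * a $ i" if i: "i < d" for c i
  proof (cases "0 \<le> c")
    case True
    thus ?thesis using sublinearD(2)[OF p2(1), of "unit_vec d i" c] i by (simp add: a_def)
  next
    case False
    have "c \<cdot>\<^sub>v unit_vec d i = (- c) \<cdot>\<^sub>v (- unit_vec d i)" by (auto intro!: eq_vecI)
    hence "p2 (c \<cdot>\<^sub>v unit_vec d i) = - c * p2 (- unit_vec d i)"
      using sublinearD(2)[OF p2(1), of "- unit_vec d i" "- c"] False by simp
    also have "\<dots> \<le> - c * - p2 (unit_vec d i)"
      using False unit[OF i] by (intro mult_left_mono) auto
    finally show ?thesis using i by (simp add: a_def)
  qed
  have upper: "p2 x \<le> a \<bullet> x" if x: "x \<in> carrier_vec d" for x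
  proof -
    define cut where "cut k = vec d (\<lambda>i. if i < k then x $ i else 0)" for k
    have sum: "p2 (cut k) \<le> (\<Sum>i<k. x $ i * a $ i)" if "k \<le> d" for k
      using that
    proof (induction k)
      case 0
      have "cut 0 = 0\<^sub>v d" by (auto simp: cut_def intro!: eq_vecI)
      thus ?case using sublinear_zero[OF p2(1)] by simp
    next
      case (Suc k)
      have "cut (Suc k) = cut k + x $ k \<cdot>\<^sub>v unit_vec d k"
        using Suc.prems by (auto simp: cut_def unit_vec_def less_Suc_eq intro!: eq_vecI)
      hence "p2 (cut (Suc k)) \<le> p2 (cut k) + p2 (x $ k \<cdot>\<^sub>v unit_vec d k)"
        using sublinearD(1)[OF p2(1), of "cut k" "x $ k \<cdot>\<^sub>v unit_vec d k"] by (simp add: cut_def)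
      thus ?case using Suc coord[of k "x $ k"] by simp
    qed
    have "cut d = x" using x by (auto simp: cut_def intro!: eq_vecI)
    moreover have "a \<bullet> x = (\<Sum>i<d. x $ i * a $ i)"
      using x by (simp add: scalar_prod_def lessThan_atLeast0 mult.commute)
    ultimately show ?thesis using sum[of d] by simp
  qed
  have lower: "a \<bullet> x \<le> p2 x" if x: "x \<in> carrier_vec d" for x
  proof -
    have "0 = p2 (x + - x)" using sublinear_zero[OF p2(1)] x by simp
    also have "\<dots> \<le> p2 x + p2 (- x)" by (rule sublinearD(1)[OF p2(1)]) (use x in auto)
    also have "p2 (- x) \<le> - (a \<bullet> x)" using upper[of "- x"] x a by simp
    finally show ?thesis by simp
  qed
  have dom: "a \<bullet> x \<le> p x" if x: "x \<in> carrier_vec d" for x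
    using lower[OF x] p1(2)[OF x] p2(2)[OF x] by simp
  have "p w \<le> a \<bullet> w" using lower[of "- w"] p2(2)[of "- w"] p1(3) a w by simp
  hence "a \<bullet> w = p w" using dom[OF w] by simp
  thus ?thesis using that a dom by blast
qed

lemma is_vec_norm_sublinear: "is_vec_norm d N \<Longrightarrow> sublinear d N"
  by (auto simp: is_vec_norm_def sublinear_def)

text \<open>The value \<open>1\<close> of the dual norm for nonzero \<open>w\<close> is what forces the constant of the adjoint bound to
  be nonnegative.\<close>

lemma norming_functional:
  assumes N: "is_vec_norm d N" and w: "w \<in> carrier_vec d"
  obtains a where "a \<in> carrier_vec d" "a \<bullet> w = N w" "dual_norm d N a \<le> 1"
    and "w \<noteq> 0\<^sub>v d \<Longrightarrow> dual_norm d N a = 1"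
proof -
  obtain a where a: "a \<in> carrier_vec d" "a \<bullet> w = N w" "\<And>x. x \<in> carrier_vec d \<Longrightarrow> a \<bullet> x \<le> N x"
    using sublinear_support[OF is_vec_norm_sublinear[OF N] w] by blast
  have N0: "N (0\<^sub>v d) = 0" by (rule sublinear_zero[OF is_vec_norm_sublinear[OF N]])
  have le1: "a \<bullet> x \<le> 1" if "x \<in> {x \<in> carrier_vec d. N x \<le> 1}" for x
    using a(3)[of x] that by auto
  have ne: "{x \<in> carrier_vec d. N x \<le> 1} \<noteq> {}" using N0 by (auto intro!: exI[of _ "0\<^sub>v d"])
  have dual: "dual_norm d N a \<le> 1" unfolding dual_norm_def by (rule cSUP_least[OF ne le1])
  have "dual_norm d N a = 1" if w0: "w \<noteq> 0\<^sub>v d"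
  proof -
    have Nw: "N w > 0" using N w w0 unfolding is_vec_norm_def by force
    define u where "u = inverse (N w) \<cdot>\<^sub>v w"
    have u: "u \<in> carrier_vec d" "N u = 1" "a \<bullet> u = 1"
      using N w Nw a by (auto simp: u_def is_vec_norm_def)
    have "a \<bullet> u \<le> dual_norm d N a"
      unfolding dual_norm_def
      by (rule cSUP_upper) (use u le1 in \<open>auto intro!: bdd_aboveI[of _ 1]\<close>)
    thus ?thesis using dual u(3) by simp
  qed
  thus ?thesis using that a dual by blast
qed

section \<open>Functions of one real variable\<close>

text \<open>The descent lemma for a one-sided Lipschitz condition on the derivative, with the tangent taken
  at the left and at the right end point.\<close>

lemma quadratic_upper_bound:
  fixes \<phi> \<phi>' :: "real \<Rightarrow> real"
  assumes ab: "a \<le> b"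
    and der: "\<And>t. a \<le> t \<Longrightarrow> t \<le> b \<Longrightarrow> (\<phi> has_real_derivative \<phi>' t) (at t)"
    and lip: "\<And>s t. a \<le> s \<Longrightarrow> s \<le> t \<Longrightarrow> t \<le> b \<Longrightarrow> \<phi>' t - \<phi>' s \<le> K * (t - s)"
  shows "\<phi> b \<le> \<phi> a + \<phi>' a * (b - a) + K * (b - a)\<^sup>2 / 2"
    and "\<phi> a \<le> \<phi> b - \<phi>' b * (b - a) + K * (b - a)\<^sup>2 / 2"
proof -
  define \<psi> where "\<psi> t = \<phi> t - \<phi>' a * (t - a) - K * (t - a)\<^sup>2 / 2" for t
  have "\<psi> b \<le> \<psi> a"
  proof (rule DERIV_nonpos_imp_nonincreasing[OF ab])
    fix t assume t: "a \<le> t" "t \<le> b"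
    have "(\<psi> has_real_derivative (\<phi>' t - \<phi>' a - K * (t - a))) (at t)"
      unfolding \<psi>_def by (auto intro!: derivative_eq_intros der t)
    thus "\<exists>y. (\<psi> has_real_derivative y) (at t) \<and> y \<le> 0" using lip[of a t] t by force
  qed
  thus "\<phi> b \<le> \<phi> a + \<phi>' a * (b - a) + K * (b - a)\<^sup>2 / 2" by (simp add: \<psi>_def)
  define \<chi> where "\<chi> t = \<phi> t - \<phi>' b * (t - b) - K * (t - b)\<^sup>2 / 2" for t
  have "\<chi> a \<le> \<chi> b"
  proof (rule DERIV_nonneg_imp_nondecreasing[OF ab])
    fix t assume t: "a \<le> t" "t \<le> b"
    have "(\<chi> has_real_derivative (\<phi>' t - \<phi>' b - K * (t - b))) (at t)"
      unfolding \<chi>_def by (auto intro!: derivative_eq_intros der t)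
    moreover have "0 \<le> \<phi>' t - \<phi>' b - K * (t - b)" using lip[of t b] t by (simp add: algebra_simps)
    ultimately show "\<exists>y. (\<chi> has_real_derivative y) (at t) \<and> y \<ge> 0" by blast
  qed
  thus "\<phi> a \<le> \<phi> b - \<phi>' b * (b - a) + K * (b - a)\<^sup>2 / 2"
    by (simp add: \<chi>_def power2_commute[of a b] algebra_simps)
qed

text \<open>The derivative vanishes at an interior minimizer; at the end point \<open>0\<close> of the ray only its sign is
  determined.\<close>

lemma ray_minimizer_derivative:
  fixes \<phi> :: "real \<Rightarrow> real"
  assumes der: "(\<phi> has_real_derivative D) (at \<theta>)" and \<theta>: "0 \<le> \<theta>"
    and r: "r > 0" and min: "\<And>s. 0 \<le> s \<Longrightarrow> \<bar>s - \<theta>\<bar> < r \<Longrightarrow> \<phi> \<theta> \<le> \<phi> s"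
  shows "0 \<le> D" and "\<theta> * D = 0"
proof -
  show "0 \<le> D"
  proof (rule ccontr)
    assume "\<not> 0 \<le> D"
    then obtain e where e: "e > 0" "\<And>h. 0 < h \<Longrightarrow> h < e \<Longrightarrow> \<phi> (\<theta> + h) < \<phi> \<theta>"
      using DERIV_neg_dec_right[OF der] by auto
    let ?h = "min e r / 2"
    have "\<phi> (\<theta> + ?h) < \<phi> \<theta>" using e(1) r by (intro e(2)) auto
    moreover have "\<phi> \<theta> \<le> \<phi> (\<theta> + ?h)" using e(1) r \<theta> by (intro min) auto
    ultimately show False by simp
  qed
  show "\<theta> * D = 0"
  proof (cases "\<theta> = 0")
    case False
    have "D = 0"
      by (rule DERIV_local_min[OF der, of "min r \<theta>"]) (use False \<theta> r min in \<open>auto simp: abs_minus_commute\<close>)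
    thus ?thesis by simp
  qed simp
qed

section \<open>Gradients\<close>

text \<open>The argument for the uniqueness of gradients, common to vectors and matrices. In the applications
  \<open>w s = s (g - g')\<close> and \<open>m\<close> is the length of \<open>g - g'\<close>.\<close>

lemma has_gradient_difference_zero:
  assumes g: "has_gradient V ip h x g" and g': "has_gradient V ip h x g'"
    and w: "\<And>s. s > 0 \<Longrightarrow> w s \<in> V"
    and diff: "\<And>s. s > 0 \<Longrightarrow> ip g (w s) - ip g' (w s) = s * m\<^sup>2"
    and norm: "\<And>s. s > 0 \<Longrightarrow> sqrt (ip (w s) (w s)) = s * m"
    and m: "0 \<le> m"
  shows "m = 0"
proof (rule ccontr)
  assume "m \<noteq> 0"
  hence m0: "m > 0" using m by simp
  hence "m / 4 > 0" by simp
  then obtain r r' where r: "r > 0" "r' > 0"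
    and br: "\<And>v. v \<in> V \<Longrightarrow> sqrt (ip v v) < r \<Longrightarrow> \<bar>h (x + v) - h x - ip g v\<bar> \<le> m / 4 * sqrt (ip v v)"
    and br': "\<And>v. v \<in> V \<Longrightarrow> sqrt (ip v v) < r' \<Longrightarrow> \<bar>h (x + v) - h x - ip g' v\<bar> \<le> m / 4 * sqrt (ip v v)"
    using g g' unfolding has_gradient_def by metis
  (* Any s with s * m below both radii would do. *)
  define s where "s = min r r' / (2 * m)"
  have s: "s > 0" using r m0 by (simp add: s_def)
  have sm: "s * m < r" "s * m < r'" using r m0 by (auto simp: s_def)
  have "\<bar>h (x + w s) - h x - ip g (w s)\<bar> \<le> m / 4 * (s * m)"
    "\<bar>h (x + w s) - h x - ip g' (w s)\<bar> \<le> m / 4 * (s * m)"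
    using br[OF w[OF s]] br'[OF w[OF s]] norm[OF s] sm by auto
  hence "ip g (w s) - ip g' (w s) \<le> m / 4 * (s * m) + m / 4 * (s * m)" by linarith
  hence "s * m\<^sup>2 \<le> s * m\<^sup>2 / 2" using diff[OF s] by (simp add: power2_eq_square algebra_simps)
  moreover have "s * m\<^sup>2 > 0" using s m0 by simp
  ultimately show False by simp
qed

lemma vec_gradient_eqI:
  assumes g: "has_gradient (carrier_vec d) (\<bullet>) h x g"
  shows "gradient (carrier_vec d) (\<bullet>) h x = g"
  unfolding gradient_def
proof (rule the_equality)
  show "has_gradient (carrier_vec d) (\<bullet>) h x g" by (rule g)
  fix g' :: "real vec" assume g': "has_gradient (carrier_vec d) (\<bullet>) h x g'"
  have c: "g \<in> carrier_vec d" "g' \<in> carrier_vec d" using g g' by (auto simp: has_gradient_def)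
  let ?e = "g - g'"
  have ec: "?e \<in> carrier_vec d" using c by simp
  have "sqrt (?e \<bullet> ?e) = 0"
  proof (rule has_gradient_difference_zero[OF g g', where w = "\<lambda>s. s \<cdot>\<^sub>v ?e"])
    fix s :: real assume s: "s > 0"
    show "g \<bullet> (s \<cdot>\<^sub>v ?e) - g' \<bullet> (s \<cdot>\<^sub>v ?e) = s * (sqrt (?e \<bullet> ?e))\<^sup>2"
    proof -
      have "?e \<bullet> ?e = g \<bullet> ?e - g' \<bullet> ?e" using c ec by (simp add: minus_scalar_prod_distrib[of _ d])
      thus ?thesis using c ec scalar_self_ge_0[of ?e] by (simp add: right_diff_distrib)
    qed
    show "sqrt ((s \<cdot>\<^sub>v ?e) \<bullet> (s \<cdot>\<^sub>v ?e)) = s * sqrt (?e \<bullet> ?e)"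
      using s ec by (simp add: real_sqrt_mult flip: mult.assoc)
  qed (use ec scalar_self_ge_0[of ?e] in auto)
  hence "?e = 0\<^sub>v d" using scalar_self_eq_0[OF ec] by simp
  show "g' = g"
  proof (rule eq_vecI)
    fix i assume i: "i < dim_vec g"
    have "?e $ i = 0" using \<open>?e = 0\<^sub>v d\<close> i c by simp
    thus "g' $ i = g $ i" using i c by simp
  qed (use c in auto)
qed

lemma sym_gradient_eqI:
  assumes g: "has_gradient (sym_mats n) trace_inner h x g"
  shows "gradient (sym_mats n) trace_inner h x = g"
  unfolding gradient_def
proof (rule the_equality)
  show "has_gradient (sym_mats n) trace_inner h x g" by (rule g)
  fix g' :: "real mat" assume g': "has_gradient (sym_mats n) trace_inner h x g'"
  have c: "g \<in> sym_mats n" "g' \<in> sym_mats n" using g g' by (auto simp: has_gradient_def)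
  note cc = c[THEN sym_matsD]
  let ?e = "g - g'"
  have ec: "?e \<in> sym_mats n" using c by (rule sym_mats_arith)
  have ecc: "?e \<in> carrier_mat n n" using ec by (rule sym_matsD)
  have nn: "0 \<le> trace_inner ?e ?e" unfolding trace_inner_self[OF ec] by (intro sum_nonneg) auto
  have "sqrt (trace_inner ?e ?e) = 0"
  proof (rule has_gradient_difference_zero[OF g g', where w = "\<lambda>s. s \<cdot>\<^sub>m ?e"])
    fix s :: real assume s: "s > 0"
    show "s \<cdot>\<^sub>m ?e \<in> sym_mats n" using ec by (rule sym_mats_arith(3)[OF _ ec])
    show "trace_inner g (s \<cdot>\<^sub>m ?e) - trace_inner g' (s \<cdot>\<^sub>m ?e) = s * (sqrt (trace_inner ?e ?e))\<^sup>2"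
    proof -
      have "trace_inner ?e ?e = trace_inner g ?e - trace_inner g' ?e"
        using trace_inner_linear(2)[OF cc ecc] .
      thus ?thesis using cc ecc nn trace_inner_linear(6)[OF ecc ecc cc(1)]
          trace_inner_linear(6)[OF ecc ecc cc(2)] by (simp add: right_diff_distrib)
    qed
    show "sqrt (trace_inner (s \<cdot>\<^sub>m ?e) (s \<cdot>\<^sub>m ?e)) = s * sqrt (trace_inner ?e ?e)"
      using s trace_inner_linear(3)[OF ecc ecc smult_carrier_mat[OF ecc]]
        trace_inner_linear(6)[OF ecc ecc ecc] by (simp add: real_sqrt_mult flip: mult.assoc)
  qed (use nn in auto)
  hence "(\<Sum>i<n. \<Sum>j<n. (?e $$ (i, j))\<^sup>2) = 0" unfolding trace_inner_self[OF ec] by simp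
  hence "\<forall>i\<in>{..<n}. (\<Sum>j<n. (?e $$ (i, j))\<^sup>2) = 0"
    by (subst (asm) sum_nonneg_eq_0_iff) (auto intro!: sum_nonneg)
  hence z: "?e $$ (i, j) = 0" if "i < n" "j < n" for i j
    using that by (subst (asm) sum_nonneg_eq_0_iff) auto
  show "g' = g" using z cc by (intro eq_matI) auto
qed

section \<open>The constraint map and its adjoint\<close>

lemma G_map_carrier: "G_map d G A \<in> carrier_vec d"
  by (simp add: G_map_def)

lemma G_map_linear:
  assumes G: "\<And>i. i < d \<Longrightarrow> G i \<in> sym_mats n"
    and A: "A \<in> carrier_mat n n" and B: "B \<in> carrier_mat n n"
  shows "G_map d G (A + B) = G_map d G A + G_map d G B"
    and "G_map d G (c \<cdot>\<^sub>m A) = c \<cdot>\<^sub>v G_map d G A"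
proof -
  have "mat_trace (G i * (A + B)) = mat_trace (G i * A) + mat_trace (G i * B)"
    "mat_trace (G i * (c \<cdot>\<^sub>m A)) = c * mat_trace (G i * A)" if "i < d" for i
    using trace_inner_linear(4,6)[OF A B sym_matsD[OF G[OF that]]] by (simp_all add: trace_inner_def)
  thus "G_map d G (A + B) = G_map d G A + G_map d G B" "G_map d G (c \<cdot>\<^sub>m A) = c \<cdot>\<^sub>v G_map d G A"
    by (auto simp: G_map_def intro!: eq_vecI)
qed

lemma G_adj_sym:
  assumes "\<And>i. i < d \<Longrightarrow> G i \<in> sym_mats n"
  shows "G_adj n d G a \<in> sym_mats n"
  using sym_mats_index[OF assms] by (auto simp: sym_mats_def G_adj_def intro!: eq_matI sum.cong)

lemma G_adj_linear:
  assumes "a \<in> carrier_vec d" "b \<in> carrier_vec d"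
  shows "G_adj n d G (a + b) = G_adj n d G a + G_adj n d G b"
    and "G_adj n d G (a - b) = G_adj n d G a - G_adj n d G b"
    and "G_adj n d G (c \<cdot>\<^sub>v a) = c \<cdot>\<^sub>m G_adj n d G a"
  using assms
  by (auto simp: G_adj_def distrib_right left_diff_distrib sum.distrib sum_subtractf
      sum_distrib_left mult.assoc intro!: eq_matI sum.cong)

lemma trace_inner_G_adj:
  assumes G: "\<And>i. i < d \<Longrightarrow> G i \<in> sym_mats n" and A: "A \<in> carrier_mat n n"
  shows "trace_inner (G_adj n d G a) A = a \<bullet> G_map d G A"
proof -
  have "trace_inner (G_adj n d G a) A = (\<Sum>i<n. \<Sum>j<n. \<Sum>l<d. a $ l * G l $$ (i, j) * A $$ (j, i))"
    unfolding trace_inner_def using A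
    by (subst mat_trace_mult[of _ n n]) (auto simp: G_adj_def sum_distrib_right intro!: sum.cong)
  also have "\<dots> = (\<Sum>l<d. \<Sum>i<n. \<Sum>j<n. a $ l * G l $$ (i, j) * A $$ (j, i))"
    by (simp add: sum.swap[of _ "{..<n}" "{..<d}"])
  also have "\<dots> = (\<Sum>l<d. a $ l * mat_trace (G l * A))"
    using mat_trace_mult[OF sym_matsD[OF G] A]
    by (auto simp: sum_distrib_left mult.assoc intro!: sum.cong)
  also have "\<dots> = a \<bullet> G_map d G A"
    by (simp add: scalar_prod_def G_map_def lessThan_atLeast0)
  finally show ?thesis .
qed

text \<open>Continuity of the constraint map, which transfers Frechet differentiability from \<open>f\<close> to the
  composition. Every entry of \<open>A\<close> is at most its Frobenius norm, so the bound follows entrywise.\<close>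

lemma G_map_bounded:
  assumes G: "\<And>i. i < d \<Longrightarrow> G i \<in> sym_mats n"
  obtains K where "K > 0"
    and "\<And>A. A \<in> sym_mats n \<Longrightarrow> sqrt (G_map d G A \<bullet> G_map d G A) \<le> K * sqrt (trace_inner A A)"
proof
  let ?c = "\<lambda>l. \<Sum>i<n. \<Sum>j<n. \<bar>G l $$ (i, j)\<bar>"
  let ?K = "1 + (\<Sum>l<d. (?c l)\<^sup>2)"
  have K1: "?K \<ge> 1" by (simp add: sum_nonneg)
  thus "?K > 0" by linarith
  fix A assume A: "A \<in> sym_mats n"
  define s where "s = sqrt (trace_inner A A)"
  have s0: "0 \<le> s" unfolding s_def trace_inner_self[OF A] by (auto intro!: sum_nonneg)
  have entry: "\<bar>A $$ (i, j)\<bar> \<le> s" if i: "i < n" and j: "j < n" for i j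
  proof -
    have "(A $$ (i, j))\<^sup>2 \<le> (\<Sum>j<n. (A $$ (i, j))\<^sup>2)"
      by (rule member_le_sum) (use j in auto)
    also have "\<dots> \<le> (\<Sum>i<n. \<Sum>j<n. (A $$ (i, j))\<^sup>2)"
      by (rule member_le_sum[where f = "\<lambda>i. \<Sum>j<n. (A $$ (i, j))\<^sup>2"]) (use i in \<open>auto intro!: sum_nonneg\<close>)
    finally show ?thesis unfolding s_def trace_inner_self[OF A] by (rule real_le_rsqrt[of "\<bar>_\<bar>", simplified])
  qed
  have comp: "\<bar>G_map d G A $ l\<bar> \<le> ?c l * s" if l: "l < d" for l
  proof -
    have "G_map d G A $ l = (\<Sum>i<n. \<Sum>j<n. G l $$ (i, j) * A $$ (j, i))"
      using l mat_trace_mult[OF sym_matsD[OF G[OF l]] sym_matsD[OF A]] by (simp add: G_map_def)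
    also have "\<bar>\<dots>\<bar> \<le> (\<Sum>i<n. \<Sum>j<n. \<bar>G l $$ (i, j) * A $$ (j, i)\<bar>)"
      by (rule order_trans[OF sum_abs], rule sum_mono, rule sum_abs)
    also have "\<dots> \<le> (\<Sum>i<n. \<Sum>j<n. \<bar>G l $$ (i, j)\<bar> * s)"
      by (intro sum_mono) (auto simp: abs_mult intro!: mult_left_mono entry)
    finally show ?thesis by (simp add: sum_distrib_right)
  qed
  have "G_map d G A \<bullet> G_map d G A = (\<Sum>l<d. \<bar>G_map d G A $ l\<bar>\<^sup>2)"
    by (simp add: scalar_prod_def G_map_def lessThan_atLeast0 power2_eq_square)
  also have "\<dots> \<le> (\<Sum>l<d. (?c l * s)\<^sup>2)"
    by (intro sum_mono power_mono comp) auto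
  also have "\<dots> = (\<Sum>l<d. (?c l)\<^sup>2) * s\<^sup>2"
    unfolding power_mult_distrib by (rule sum_distrib_right[symmetric])
  also have "\<dots> \<le> ?K\<^sup>2 * s\<^sup>2"
  proof (rule mult_right_mono)
    have "(\<Sum>l<d. (?c l)\<^sup>2) \<le> ?K" by simp
    also have "?K \<le> ?K\<^sup>2" by (rule self_le_power[OF K1]) simp
    finally show "(\<Sum>l<d. (?c l)\<^sup>2) \<le> ?K\<^sup>2" .
  qed simp
  also have "\<dots> = (?K * s)\<^sup>2" by (simp only: power_mult_distrib)
  finally show "sqrt (G_map d G A \<bullet> G_map d G A) \<le> ?K * sqrt (trace_inner A A)"
    unfolding s_def[symmetric] using s0 K1 by (intro real_le_lsqrt) (auto simp: mult_nonneg_nonneg)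
qed

section \<open>The objective as a function of the matrix variable\<close>

locale psd_composite_problem =
  fixes n d :: nat and D :: "real vec set" and f :: "real vec \<Rightarrow> real"
    and G :: "nat \<Rightarrow> real mat" and z :: "real vec"
  assumes z: "z \<in> carrier_vec d"
    and G: "\<And>i. i < d \<Longrightarrow> G i \<in> sym_mats n"
    and D_open: "open_subset (carrier_vec d) (\<bullet>) D"
    and f_diff: "differentiable_on_set (carrier_vec d) (\<bullet>) D f"
    and f_convex: "strictly_convex_on D f"
begin

definition feas :: "real mat set" where
  "feas = {A \<in> sym_mats n. G_map d G A - z \<in> D}"

definition h :: "real mat \<Rightarrow> real" where
  "h A = f (G_map d G A - z)"

definition f_grad :: "real vec \<Rightarrow> real vec" where
  "f_grad u = gradient (carrier_vec d) (\<bullet>) f u"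

definition h_grad :: "real mat \<Rightarrow> real mat" where
  "h_grad A = G_adj n d G (f_grad (G_map d G A - z))"

lemma D_carrier: "u \<in> D \<Longrightarrow> u \<in> carrier_vec d"
  using D_open by (auto simp: open_subset_def)

lemma has_gradient_f_grad:
  assumes "u \<in> D"
  shows "has_gradient (carrier_vec d) (\<bullet>) f u (f_grad u)"
proof -
  obtain g where g: "has_gradient (carrier_vec d) (\<bullet>) f u g"
    using f_diff assms by (auto simp: differentiable_on_set_def)
  show ?thesis unfolding f_grad_def vec_gradient_eqI[OF g] by (rule g)
qed

lemma f_grad_carrier: "u \<in> D \<Longrightarrow> f_grad u \<in> carrier_vec d"
  using has_gradient_f_grad by (auto simp: has_gradient_def)

lemma feasD: "A \<in> feas \<Longrightarrow> A \<in> sym_mats n" "A \<in> feas \<Longrightarrow> G_map d G A - z \<in> D"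
  by (auto simp: feas_def)

lemma h_grad_sym: "h_grad A \<in> sym_mats n"
  unfolding h_grad_def by (rule G_adj_sym[OF G])

lemma G_map_add:
  assumes "A \<in> carrier_mat n n" "B \<in> carrier_mat n n"
  shows "G_map d G (A + B) = G_map d G A + G_map d G B"
  by (rule G_map_linear(1)[OF _ assms]) (rule G)

lemma G_map_smult:
  assumes "A \<in> carrier_mat n n"
  shows "G_map d G (c \<cdot>\<^sub>m A) = c \<cdot>\<^sub>v G_map d G A"
  by (rule G_map_linear(2)[OF _ assms assms]) (rule G)

lemma G_map_zero: "G_map d G (0\<^sub>m n n) = 0\<^sub>v d"
  using mat_trace_mult[OF sym_matsD[OF G] zero_carrier_mat]
  by (auto simp: G_map_def intro!: eq_vecI)

lemma residual_add:
  assumes "A \<in> sym_mats n" "B \<in> sym_mats n"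
  shows "G_map d G (A + t \<cdot>\<^sub>m B) - z = (G_map d G A - z) + t \<cdot>\<^sub>v G_map d G B"
proof -
  note c = assms[THEN sym_matsD]
  have "G_map d G (A + t \<cdot>\<^sub>m B) = G_map d G A + t \<cdot>\<^sub>v G_map d G B"
    using G_map_add[OF c(1), of "t \<cdot>\<^sub>m B"] G_map_smult[OF c(2)] c by simp
  thus ?thesis using z carrier_vecD[OF G_map_carrier] by (intro eq_vecI) auto
qed

text \<open>The chain rule; it identifies the gradient in the smoothness hypothesis on \<open>f \<circ> \<G>\<close> as the
  adjoint image of the gradient of \<open>f\<close>.\<close>

lemma h_has_gradient:
  assumes A: "A \<in> feas"
  shows "has_gradient (sym_mats n) trace_inner h A (h_grad A)"
  unfolding has_gradient_def
proof (intro conjI allI impI)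
  show "h_grad A \<in> sym_mats n" by (rule h_grad_sym)
  fix e :: real assume e: "e > 0"
  obtain K where K: "K > 0"
    "\<And>A. A \<in> sym_mats n \<Longrightarrow> sqrt (G_map d G A \<bullet> G_map d G A) \<le> K * sqrt (trace_inner A A)"
    using G_map_bounded[of d G n] G by blast
  let ?u = "G_map d G A - z"
  have "e / K > 0" using e K by simp
  then obtain r where r: "r > 0" "\<And>v. v \<in> carrier_vec d \<Longrightarrow> sqrt (v \<bullet> v) < r \<Longrightarrow>
      \<bar>f (?u + v) - f ?u - f_grad ?u \<bullet> v\<bar> \<le> e / K * sqrt (v \<bullet> v)"
    using has_gradient_f_grad[OF feasD(2)[OF A]] unfolding has_gradient_def by metis
  show "\<exists>r>0. \<forall>V\<in>sym_mats n. sqrt (trace_inner V V) < r \<longrightarrow>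
      \<bar>h (A + V) - h A - trace_inner (h_grad A) V\<bar> \<le> e * sqrt (trace_inner V V)"
  proof (intro exI[of _ "r / K"] conjI ballI impI)
    show "r / K > 0" using r K by simp
    fix V assume V: "V \<in> sym_mats n" and small: "sqrt (trace_inner V V) < r / K"
    let ?v = "G_map d G V"
    have "K * sqrt (trace_inner V V) < r" using small K(1) by (simp add: field_simps)
    hence "sqrt (?v \<bullet> ?v) < r" using K(2)[OF V] by simp
    hence "\<bar>f (?u + ?v) - f ?u - f_grad ?u \<bullet> ?v\<bar> \<le> e / K * sqrt (?v \<bullet> ?v)"
      by (intro r(2) G_map_carrier)
    also have "\<dots> \<le> e / K * (K * sqrt (trace_inner V V))"
      using e K(1) by (intro mult_left_mono K(2)[OF V]) auto
    also have "\<dots> = e * sqrt (trace_inner V V)" using K(1) by simp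
    finally have "\<bar>f (?u + ?v) - f ?u - f_grad ?u \<bullet> ?v\<bar> \<le> e * sqrt (trace_inner V V)" .
    moreover have "G_map d G (A + V) - z = ?u + ?v"
    proof -
      have "1 \<cdot>\<^sub>m V = V" using sym_matsD[OF V] by (intro eq_matI) auto
      moreover have "1 \<cdot>\<^sub>v ?v = ?v" by simp
      ultimately show ?thesis using residual_add[OF feasD(1)[OF A] V, of 1] by simp
    qed
    moreover have "trace_inner (h_grad A) V = f_grad ?u \<bullet> ?v"
      unfolding h_grad_def by (rule trace_inner_G_adj[OF G sym_matsD[OF V]])
    ultimately show "\<bar>h (A + V) - h A - trace_inner (h_grad A) V\<bar> \<le> e * sqrt (trace_inner V V)"
      by (simp add: h_def)
  qed
qed

lemma gradient_h: "A \<in> feas \<Longrightarrow> gradient (sym_mats n) trace_inner h A = h_grad A"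
  by (rule sym_gradient_eqI[OF h_has_gradient])

lemma sym_mats_line:
  assumes "A \<in> sym_mats n" "P \<in> sym_mats n"
  shows "A + t \<cdot>\<^sub>m P \<in> sym_mats n"
  using assms by (intro sym_mats_arith(1) sym_mats_arith(3)[of P n P])

lemma line_shift:
  assumes "A \<in> carrier_mat n n" "P \<in> carrier_mat n n"
  shows "(A + s \<cdot>\<^sub>m P) + t \<cdot>\<^sub>m P = A + (s + t) \<cdot>\<^sub>m (P :: real mat)"
  using assms by (intro eq_matI) (auto simp: distrib_right)

lemma line_zero:
  assumes "A \<in> carrier_mat n n" "P \<in> carrier_mat n n"
  shows "A + 0 \<cdot>\<^sub>m P = (A :: real mat)"
  using assms by (intro eq_matI) auto

lemma line_one:
  assumes "A \<in> carrier_mat n n" "P \<in> carrier_mat n n"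
  shows "A + 1 \<cdot>\<^sub>m P = (A + P :: real mat)"
  using assms by (intro eq_matI) auto

lemma D_line_open:
  assumes u: "u \<in> D" and w: "w \<in> carrier_vec d"
  obtains r where "r > 0" "\<And>t. \<bar>t\<bar> < r \<Longrightarrow> u + t \<cdot>\<^sub>v w \<in> D"
proof -
  obtain r where r: "r > 0" "\<And>v. v \<in> carrier_vec d \<Longrightarrow> sqrt (v \<bullet> v) < r \<Longrightarrow> u + v \<in> D"
    using D_open u by (auto simp: open_subset_def)
  let ?k = "1 + sqrt (w \<bullet> w)"
  have k: "?k > 0" using scalar_self_ge_0[of w] by (simp add: add_pos_nonneg)
  show ?thesis
  proof
    show "r / ?k > 0" using r k by simp
    fix t assume "\<bar>t\<bar> < r / ?k"
    hence "\<bar>t\<bar> * ?k < r" using k by (simp add: pos_less_divide_eq)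
    moreover have "sqrt ((t \<cdot>\<^sub>v w) \<bullet> (t \<cdot>\<^sub>v w)) = \<bar>t\<bar> * sqrt (w \<bullet> w)"
      using w by (simp add: real_sqrt_mult real_sqrt_abs2 flip: mult.assoc)
    ultimately have "sqrt ((t \<cdot>\<^sub>v w) \<bullet> (t \<cdot>\<^sub>v w)) < r" by (simp add: distrib_left)
    thus "u + t \<cdot>\<^sub>v w \<in> D" using w by (intro r(2)) auto
  qed
qed

lemma f_line_derivative:
  assumes u: "u \<in> D" and w: "w \<in> carrier_vec d"
  shows "((\<lambda>t. f (u + t \<cdot>\<^sub>v w)) has_real_derivative f_grad u \<bullet> w) (at 0)"
  unfolding DERIV_def
proof (rule LIM_I)
  fix e :: real assume e: "e > 0"
  let ?k = "1 + sqrt (w \<bullet> w)"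
  have k: "?k > 0" using scalar_self_ge_0[of w] by (simp add: add_pos_nonneg)
  have "e / ?k > 0" using e k by simp
  then obtain r where r: "r > 0" "\<And>v. v \<in> carrier_vec d \<Longrightarrow> sqrt (v \<bullet> v) < r \<Longrightarrow>
      \<bar>f (u + v) - f u - f_grad u \<bullet> v\<bar> \<le> e / ?k * sqrt (v \<bullet> v)"
    using has_gradient_f_grad[OF u] unfolding has_gradient_def by metis
  have uc: "u \<in> carrier_vec d" and gc: "f_grad u \<in> carrier_vec d"
    using D_carrier[OF u] f_grad_carrier[OF u] by auto
  have u0: "u + 0 \<cdot>\<^sub>v w = u" using uc w by (intro eq_vecI) auto
  show "\<exists>r>0. \<forall>t. t \<noteq> 0 \<and> norm (t - 0) < r \<longrightarrow>
      norm ((f (u + (0 + t) \<cdot>\<^sub>v w) - f (u + 0 \<cdot>\<^sub>v w)) / t - f_grad u \<bullet> w) < e"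
  proof (intro exI[of _ "r / ?k"] conjI allI impI)
    show "r / ?k > 0" using r k by simp
    fix t :: real assume t: "t \<noteq> 0 \<and> norm (t - 0) < r / ?k"
    hence tk: "\<bar>t\<bar> * ?k < r" using k by (simp add: pos_less_divide_eq)
    have nt: "sqrt ((t \<cdot>\<^sub>v w) \<bullet> (t \<cdot>\<^sub>v w)) = \<bar>t\<bar> * sqrt (w \<bullet> w)"
      using w by (simp add: real_sqrt_mult real_sqrt_abs2 flip: mult.assoc)
    with tk have small: "sqrt ((t \<cdot>\<^sub>v w) \<bullet> (t \<cdot>\<^sub>v w)) < r" by (simp add: distrib_left)
    let ?R = "f (u + t \<cdot>\<^sub>v w) - f u - t * (f_grad u \<bullet> w)"
    have "\<bar>?R\<bar> \<le> e / ?k * (\<bar>t\<bar> * sqrt (w \<bullet> w))"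
      using r(2)[OF _ small] w nt gc by simp
    also have "\<dots> = \<bar>t\<bar> * (e * (sqrt (w \<bullet> w) / ?k))" by simp
    also have "\<dots> < \<bar>t\<bar> * (e * 1)"
      using t e k by (intro mult_strict_left_mono) (auto simp: divide_less_eq_1)
    finally have "\<bar>?R\<bar> / \<bar>t\<bar> < e" using t by (simp add: pos_divide_less_eq mult.commute)
    moreover have "(f (u + t \<cdot>\<^sub>v w) - f u) / t - f_grad u \<bullet> w = ?R / t"
      using t by (simp add: field_simps)
    ultimately show "norm ((f (u + (0 + t) \<cdot>\<^sub>v w) - f (u + 0 \<cdot>\<^sub>v w)) / t - f_grad u \<bullet> w) < e"
      by (simp add: u0 abs_divide)
  qed
qed

lemma feas_line_open:
  assumes A: "A \<in> sym_mats n" and P: "P \<in> sym_mats n" and t: "A + t \<cdot>\<^sub>m P \<in> feas"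
  obtains r where "r > 0" "\<And>s. \<bar>s - t\<bar> < r \<Longrightarrow> A + s \<cdot>\<^sub>m P \<in> feas"
proof -
  obtain r where r: "r > 0"
    "\<And>e. \<bar>e\<bar> < r \<Longrightarrow> (G_map d G (A + t \<cdot>\<^sub>m P) - z) + e \<cdot>\<^sub>v G_map d G P \<in> D"
    using D_line_open[OF feasD(2)[OF t] G_map_carrier] by blast
  have "A + s \<cdot>\<^sub>m P \<in> feas" if "\<bar>s - t\<bar> < r" for s
    using r(2)[OF that] residual_add[OF feasD(1)[OF t] P, of "s - t"]
      line_shift[OF A[THEN sym_matsD] P[THEN sym_matsD], of t "s - t"] sym_mats_line[OF A P]
    by (simp add: feas_def)
  thus ?thesis using that r(1) by blast
qed

lemma h_line_derivative:
  assumes A: "A \<in> sym_mats n" and P: "P \<in> sym_mats n" and t: "A + t \<cdot>\<^sub>m P \<in> feas"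
  shows "((\<lambda>s. h (A + s \<cdot>\<^sub>m P)) has_real_derivative trace_inner (h_grad (A + t \<cdot>\<^sub>m P)) P) (at t)"
proof -
  let ?u = "G_map d G (A + t \<cdot>\<^sub>m P) - z"
  have "((\<lambda>s. f (?u + s \<cdot>\<^sub>v G_map d G P)) has_real_derivative f_grad ?u \<bullet> G_map d G P) (at 0)"
    by (rule f_line_derivative[OF feasD(2)[OF t] G_map_carrier])
  moreover have "f (?u + s \<cdot>\<^sub>v G_map d G P) = h (A + (s + t) \<cdot>\<^sub>m P)" for s
    using residual_add[OF feasD(1)[OF t] P, of s]
      line_shift[OF A[THEN sym_matsD] P[THEN sym_matsD], of t s] by (simp add: h_def add.commute)
  moreover have "f_grad ?u \<bullet> G_map d G P = trace_inner (h_grad (A + t \<cdot>\<^sub>m P)) P"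
    unfolding h_grad_def by (rule trace_inner_G_adj[OF G sym_matsD[OF P], symmetric])
  ultimately have "((\<lambda>s. h (A + (s + t) \<cdot>\<^sub>m P)) has_real_derivative
      trace_inner (h_grad (A + t \<cdot>\<^sub>m P)) P) (at 0)" by simp
  thus ?thesis using DERIV_shift[of "\<lambda>s. h (A + s \<cdot>\<^sub>m P)" _ 0 t] by simp
qed

lemma h_convex:
  assumes A: "A \<in> feas" and B: "A + P \<in> feas" and P: "P \<in> sym_mats n" and t: "0 \<le> t" "t \<le> 1"
  shows "A + t \<cdot>\<^sub>m P \<in> feas" and "h (A + t \<cdot>\<^sub>m P) \<le> h A + t * (h (A + P) - h A)"
proof -
  let ?u = "G_map d G A - z" and ?w = "G_map d G (A + P) - z"
  note c = sym_matsD[OF feasD(1)[OF A]] sym_matsD[OF P]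
  have "A + t \<cdot>\<^sub>m P \<in> feas \<and> h (A + t \<cdot>\<^sub>m P) \<le> h A + t * (h (A + P) - h A)"
  proof (cases "t = 0 \<or> t = 1")
    case True
    thus ?thesis using A B line_zero[OF c] line_one[OF c] by auto
  next
    case False
    hence t': "0 < 1 - t" "1 - t < 1" using t by auto
    have e: "G_map d G (A + t \<cdot>\<^sub>m P) - z = (1 - t) \<cdot>\<^sub>v ?u + (1 - (1 - t)) \<cdot>\<^sub>v ?w"
      using residual_add[OF feasD(1)[OF A] P, of t] residual_add[OF feasD(1)[OF A] P, of 1]
        line_one[OF c] z carrier_vecD[OF G_map_carrier]
      by (intro eq_vecI) (auto simp: algebra_simps simp del: index_minus_vec(1))
    have D: "(1 - t) \<cdot>\<^sub>v ?u + (1 - (1 - t)) \<cdot>\<^sub>v ?w \<in> D"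
      and f: "?u \<noteq> ?w \<longrightarrow> f ((1 - t) \<cdot>\<^sub>v ?u + (1 - (1 - t)) \<cdot>\<^sub>v ?w) < (1 - t) * f ?u + (1 - (1 - t)) * f ?w"
      using f_convex feasD(2)[OF A] feasD(2)[OF B] t' unfolding strictly_convex_on_def by blast+
    have "f ((1 - t) \<cdot>\<^sub>v ?u + (1 - (1 - t)) \<cdot>\<^sub>v ?w) \<le> (1 - t) * f ?u + (1 - (1 - t)) * f ?w"
    proof (cases "?u = ?w")
      case True
      have "(1 - t) \<cdot>\<^sub>v ?u + (1 - (1 - t)) \<cdot>\<^sub>v ?u = ?u" by (intro eq_vecI) (auto simp: algebra_simps)
      thus ?thesis using True by (simp add: algebra_simps)
    next
      case False
      thus ?thesis using f by simp
    qed
    thus ?thesis using D e sym_mats_line[OF feasD(1)[OF A] P]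
      by (simp add: feas_def h_def algebra_simps)
  qed
  thus "A + t \<cdot>\<^sub>m P \<in> feas" "h (A + t \<cdot>\<^sub>m P) \<le> h A + t * (h (A + P) - h A)" by auto
qed

text \<open>Let the step along the segment tend to zero in the convexity inequality.\<close>

lemma h_above_tangent:
  assumes A: "A \<in> feas" and B: "A + P \<in> feas" and P: "P \<in> sym_mats n"
  shows "h A + trace_inner (h_grad A) P \<le> h (A + P)"
proof -
  note c = sym_matsD[OF feasD(1)[OF A]] sym_matsD[OF P]
  have A0: "A + 0 \<cdot>\<^sub>m P = A" by (rule line_zero[OF c])
  have "((\<lambda>s. h (A + s \<cdot>\<^sub>m P)) has_real_derivative trace_inner (h_grad A) P) (at 0)"
    using h_line_derivative[OF feasD(1)[OF A] P, of 0] A A0 by simp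
  hence "((\<lambda>t. (h (A + t \<cdot>\<^sub>m P) - h A) / t) \<longlongrightarrow> trace_inner (h_grad A) P) (at 0)"
    unfolding DERIV_def by (simp add: A0)
  hence "((\<lambda>t. (h (A + t \<cdot>\<^sub>m P) - h A) / t) \<longlongrightarrow> trace_inner (h_grad A) P) (at_right 0)"
    by (rule tendsto_mono[OF at_le, rotated]) simp
  moreover have "eventually (\<lambda>t. (h (A + t \<cdot>\<^sub>m P) - h A) / t \<le> h (A + P) - h A) (at_right 0)"
  proof (rule eventually_at_rightI[of 0 1])
    fix t :: real assume "t \<in> {0<..<1}"
    thus "(h (A + t \<cdot>\<^sub>m P) - h A) / t \<le> h (A + P) - h A"
      using h_convex(2)[OF A B P, of t] by (simp add: pos_divide_le_eq mult.commute)
  qed simp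
  ultimately have "trace_inner (h_grad A) P \<le> h (A + P) - h A"
    by (rule tendsto_upperbound) simp
  thus ?thesis by simp
qed

lemma feas_line_interval:
  assumes A: "A \<in> sym_mats n" and P: "P \<in> sym_mats n"
    and s: "A + s \<cdot>\<^sub>m P \<in> feas" and t: "A + t \<cdot>\<^sub>m P \<in> feas" and r: "s \<le> r" "r \<le> t"
  shows "A + r \<cdot>\<^sub>m P \<in> feas"
proof (cases "s = t")
  case True
  thus ?thesis using s r by simp
next
  case False
  hence st: "s < t" using r by simp
  note c = sym_matsD[OF A] sym_matsD[OF P]
  let ?k = "(r - s) / (t - s)"
  have sc: "(A + s \<cdot>\<^sub>m P) + (k * (t - s)) \<cdot>\<^sub>m P = (A + s \<cdot>\<^sub>m P) + k \<cdot>\<^sub>m ((t - s) \<cdot>\<^sub>m P)" for k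
    using c by (intro eq_matI) auto
  have k: "?k * (t - s) = r - s" using st by simp
  have "(A + s \<cdot>\<^sub>m P) + ?k \<cdot>\<^sub>m ((t - s) \<cdot>\<^sub>m P) \<in> feas"
    by (rule h_convex(1)[OF s]) (use t st r line_shift[OF c, of s "t - s"] sym_mats_arith(3)[OF P P] in auto)
  thus ?thesis using sc[of ?k] line_shift[OF c, of s "r - s"] unfolding k by simp
qed

text \<open>Smoothness along directions of the cone, where the nuclear norm is the trace. This is the common
  consequence of the two smoothness hypotheses, the one on \<open>f\<close> and the one on \<open>f \<circ> \<G>\<close>, and the form in
  which they enter the analysis.\<close>

definition cone_smooth :: "real \<Rightarrow> bool" where
  "cone_smooth L \<longleftrightarrow> (\<forall>A \<in> psd_cone n. \<forall>P \<in> psd_cone n. A \<in> feas \<longrightarrow> A + P \<in> feas \<longrightarrow>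
     op_norm (h_grad (A + P) - h_grad A) \<le> L * mat_trace P)"

lemma cone_smooth_slope:
  assumes L: "cone_smooth L" and A: "A \<in> psd_cone n" and P: "P \<in> psd_cone n"
    and st: "0 \<le> s" "s \<le> t" and s: "A + s \<cdot>\<^sub>m P \<in> feas" and t: "A + t \<cdot>\<^sub>m P \<in> feas"
  shows "trace_inner (h_grad (A + t \<cdot>\<^sub>m P)) P - trace_inner (h_grad (A + s \<cdot>\<^sub>m P)) P
    \<le> L * (mat_trace P)\<^sup>2 * (t - s)"
proof -
  note c = psd_coneD(1)[OF A] psd_coneD(1)[OF P]
  let ?E = "h_grad (A + t \<cdot>\<^sub>m P) - h_grad (A + s \<cdot>\<^sub>m P)"
  have At: "A + t \<cdot>\<^sub>m P = (A + s \<cdot>\<^sub>m P) + (t - s) \<cdot>\<^sub>m P"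
    using line_shift[OF c, of s "t - s"] by simp
  have "trace_inner (h_grad (A + t \<cdot>\<^sub>m P)) P - trace_inner (h_grad (A + s \<cdot>\<^sub>m P)) P = trace_inner ?E P"
    by (rule trace_inner_linear(2)[symmetric]) (use h_grad_sym sym_matsD c in auto)
  also have "\<dots> \<le> op_norm ?E * mat_trace P"
    by (intro trace_inner_le_op_norm[where n = n] sym_mats_arith(2) h_grad_sym P)
  also have "\<dots> \<le> L * mat_trace ((t - s) \<cdot>\<^sub>m P) * mat_trace P"
  proof (rule mult_right_mono[OF _ psd_trace_nonneg[OF P]])
    show "op_norm ?E \<le> L * mat_trace ((t - s) \<cdot>\<^sub>m P)"
      unfolding At using L[unfolded cone_smooth_def, rule_format, of "A + s \<cdot>\<^sub>m P" "(t - s) \<cdot>\<^sub>m P"]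
        psd_cone_add[OF A psd_cone_smult[OF P st(1)]] psd_cone_smult[OF P, of "t - s"] s t st
      by (simp add: At)
  qed
  also have "\<dots> = L * (mat_trace P)\<^sup>2 * (t - s)"
    using mat_trace_linear(3)[OF c(2) c(2)] by (simp add: power2_eq_square)
  finally show ?thesis .
qed

lemma cone_smooth_quadratic_bounds:
  assumes L: "cone_smooth L" and A: "A \<in> psd_cone n" and P: "P \<in> psd_cone n"
    and t: "0 \<le> t" and f0: "A \<in> feas" and ft: "A + t \<cdot>\<^sub>m P \<in> feas"
  shows "h (A + t \<cdot>\<^sub>m P) \<le> h A + trace_inner (h_grad A) P * t + L * (mat_trace P)\<^sup>2 * t\<^sup>2 / 2"
    and "h A \<le> h (A + t \<cdot>\<^sub>m P) - trace_inner (h_grad (A + t \<cdot>\<^sub>m P)) P * t + L * (mat_trace P)\<^sup>2 * t\<^sup>2 / 2"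
proof -
  note sy = psd_coneD(2)[OF A] psd_coneD(2)[OF P]
  have A0: "A + 0 \<cdot>\<^sub>m P = A" by (rule line_zero[OF sy[THEN sym_matsD]])
  have mem: "A + s \<cdot>\<^sub>m P \<in> feas" if "0 \<le> s" "s \<le> t" for s
    by (rule feas_line_interval[OF sy, of 0 t]) (use that f0 ft A0 in auto)
  have der: "((\<lambda>s. h (A + s \<cdot>\<^sub>m P)) has_real_derivative trace_inner (h_grad (A + s \<cdot>\<^sub>m P)) P) (at s)"
    if "0 \<le> s" "s \<le> t" for s
    by (rule h_line_derivative[OF sy mem[OF that]])
  have lip: "trace_inner (h_grad (A + r \<cdot>\<^sub>m P)) P - trace_inner (h_grad (A + s \<cdot>\<^sub>m P)) P
      \<le> L * (mat_trace P)\<^sup>2 * (r - s)" if "0 \<le> s" "s \<le> r" "r \<le> t" for s r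
    by (rule cone_smooth_slope[OF L A P]) (use that mem in auto)
  show "h (A + t \<cdot>\<^sub>m P) \<le> h A + trace_inner (h_grad A) P * t + L * (mat_trace P)\<^sup>2 * t\<^sup>2 / 2"
    and "h A \<le> h (A + t \<cdot>\<^sub>m P) - trace_inner (h_grad (A + t \<cdot>\<^sub>m P)) P * t + L * (mat_trace P)\<^sup>2 * t\<^sup>2 / 2"
    using quadratic_upper_bound[OF t der lip] A0 by simp_all
qed

lemma line_search_optimality:
  assumes A: "A \<in> sym_mats n" and P: "P \<in> sym_mats n"
    and min: "is_arg_min (\<lambda>s. h (A + s \<cdot>\<^sub>m P)) (\<lambda>s. 0 \<le> s \<and> A + s \<cdot>\<^sub>m P \<in> feas) \<theta>"
  shows "0 \<le> trace_inner (h_grad (A + \<theta> \<cdot>\<^sub>m P)) P"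
    and "\<theta> * trace_inner (h_grad (A + \<theta> \<cdot>\<^sub>m P)) P = 0"
proof -
  have \<theta>: "0 \<le> \<theta>" "A + \<theta> \<cdot>\<^sub>m P \<in> feas" using min by (auto simp: is_arg_min_def)
  obtain r where r: "r > 0" "\<And>s. \<bar>s - \<theta>\<bar> < r \<Longrightarrow> A + s \<cdot>\<^sub>m P \<in> feas"
    using feas_line_open[OF A P \<theta>(2)] by blast
  have m: "h (A + \<theta> \<cdot>\<^sub>m P) \<le> h (A + s \<cdot>\<^sub>m P)" if "0 \<le> s" "\<bar>s - \<theta>\<bar> < r" for s
    using min r(2)[OF that(2)] that(1) by (auto simp: is_arg_min_def not_less)
  show "0 \<le> trace_inner (h_grad (A + \<theta> \<cdot>\<^sub>m P)) P"
    "\<theta> * trace_inner (h_grad (A + \<theta> \<cdot>\<^sub>m P)) P = 0"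
    using ray_minimizer_derivative[OF h_line_derivative[OF A P \<theta>(2)] \<theta>(1) r(1)] m by auto
qed

text \<open>The exact line search does at least as well as the quadratic model predicts for every step
  \<open>s\<close>, even if that step leaves the domain: beyond the minimizer \<open>\<theta>\<close> the model increases, because
  its slope at \<open>\<theta>\<close> is at least the slope of \<open>h\<close> there, which is nonnegative.\<close>

lemma line_search_decrease:
  assumes L: "cone_smooth L" and L0: "0 \<le> L" and A: "A \<in> psd_cone n" and P: "P \<in> psd_cone n"
    and f0: "A \<in> feas" and s: "0 \<le> s"
    and min: "is_arg_min (\<lambda>s. h (A + s \<cdot>\<^sub>m P)) (\<lambda>s. 0 \<le> s \<and> A + s \<cdot>\<^sub>m P \<in> feas) \<theta>"
  shows "h (A + \<theta> \<cdot>\<^sub>m P) \<le> h A + trace_inner (h_grad A) P * s + L * (mat_trace P)\<^sup>2 * s\<^sup>2 / 2"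
proof -
  note sy = psd_coneD(2)[OF A] psd_coneD(2)[OF P]
  have A0: "A + 0 \<cdot>\<^sub>m P = A" by (rule line_zero[OF sy[THEN sym_matsD]])
  have \<theta>: "0 \<le> \<theta>" "A + \<theta> \<cdot>\<^sub>m P \<in> feas" using min by (auto simp: is_arg_min_def)
  let ?a = "trace_inner (h_grad A) P" and ?K = "L * (mat_trace P)\<^sup>2"
  show ?thesis
  proof (cases "s \<le> \<theta>")
    case True
    have fs: "A + s \<cdot>\<^sub>m P \<in> feas"
      by (rule feas_line_interval[OF sy, of 0 \<theta>]) (use True s f0 \<theta> A0 in auto)
    have "h (A + \<theta> \<cdot>\<^sub>m P) \<le> h (A + s \<cdot>\<^sub>m P)"
      using min fs s by (auto simp: is_arg_min_def not_less)
    thus ?thesis using cone_smooth_quadratic_bounds(1)[OF L A P s f0 fs] by simp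
  next
    case False
    have "trace_inner (h_grad (A + \<theta> \<cdot>\<^sub>m P)) P - ?a \<le> ?K * \<theta>"
      using cone_smooth_slope[OF L A P, of 0 \<theta>] \<theta> f0 A0 by simp
    hence slope: "0 \<le> ?a + ?K * \<theta>" using line_search_optimality(1)[OF sy min] by simp
    have "?a * s + ?K * s\<^sup>2 / 2 - (?a * \<theta> + ?K * \<theta>\<^sup>2 / 2)
        = (s - \<theta>) * (?a + ?K * \<theta>) + ?K * (s - \<theta>)\<^sup>2 / 2"
      by (simp add: power2_eq_square field_simps)
    moreover have "0 \<le> (s - \<theta>) * (?a + ?K * \<theta>) + ?K * (s - \<theta>)\<^sup>2 / 2"
      using mult_nonneg_nonneg[OF _ slope, of "s - \<theta>"] False L0 by simp
    ultimately show ?thesis using cone_smooth_quadratic_bounds(1)[OF L A P \<theta>(1) f0 \<theta>(2)] by linarith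
  qed
qed

end

section \<open>The method in the matrix variable\<close>

text \<open>The sequence \<open>2 B / (k + 2)\<close> absorbs the error \<open>B \<delta>\<^sup>2 / 2\<close> of a step with weight \<open>\<delta> = 2 / (k + 3)\<close>.\<close>

lemma rate_recursion:
  fixes B :: real
  assumes "0 \<le> B"
  shows "(1 - 2 / (real k + 3)) * (2 * B / (real k + 2)) + B * (2 / (real k + 3))\<^sup>2 / 2
    \<le> 2 * B / (real (Suc k) + 2)"
proof -
  let ?t = "real k"
  have e: "1 - 2 / (?t + 3) = (?t + 1) / (?t + 3)" by (simp add: field_simps)
  have "(1 - 2 / (?t + 3)) * (2 * B / (?t + 2)) + B * (2 / (?t + 3))\<^sup>2 / 2
      = 2 * B / (?t + 3) * ((?t + 1) / (?t + 2)) + 2 * B / (?t + 3) * (1 / (?t + 3))"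
    unfolding e by (simp add: power2_eq_square mult.commute)
  also have "\<dots> = 2 * B / (?t + 3) * ((?t + 1) / (?t + 2) + 1 / (?t + 3))"
    by (simp only: distrib_left)
  also have "\<dots> \<le> 2 * B / (?t + 3) * 1"
  proof (rule mult_left_mono)
    have "1 / (?t + 3) \<le> 1 / (?t + 2)" by (simp add: frac_le)
    moreover have "(?t + 1) / (?t + 2) + 1 / (?t + 2) = 1" by (simp add: field_simps)
    ultimately show "(?t + 1) / (?t + 2) + 1 / (?t + 3) \<le> 1" by linarith
  qed (use assms in simp)
  finally show ?thesis by (simp add: algebra_simps)
qed

text \<open>The iteration with \<open>\<G>\<close> eliminated: \<open>M k\<close> stands for \<open>\<G>\<^sup>* g\<^sub>k\<close>, and the line searches range over
  matrices. At index \<open>k + 1\<close> the momentum weight \<open>2 / (k + 2)\<close> reads \<open>2 / (k + 3)\<close>; at index \<open>0\<close> it is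
  \<open>1\<close>, so that \<open>M 0\<close> is a plain gradient.\<close>

locale matrix_moco = psd_composite_problem +
  fixes L :: real and Xs :: "real mat" and X M :: "nat \<Rightarrow> real mat"
    and \<eta> \<theta> :: "nat \<Rightarrow> real" and q :: "nat \<Rightarrow> real vec"
  assumes smooth: "cone_smooth L" and L0: "0 \<le> L"
    and Xs: "is_arg_min h (\<lambda>A. A \<in> psd_cone n \<and> A \<in> feas) Xs"
    and X_0: "X 0 = 0\<^sub>m n n"
    and \<eta>: "\<And>k. is_arg_min (\<lambda>s. h (s \<cdot>\<^sub>m X k)) (\<lambda>s. 0 \<le> s \<and> s \<cdot>\<^sub>m X k \<in> feas) (\<eta> k)"
    and M_0: "M 0 = h_grad (\<eta> 0 \<cdot>\<^sub>m X 0)"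
    and M_Suc: "\<And>k. M (Suc k) = (1 - 2 / (real k + 3)) \<cdot>\<^sub>m M k
      + (2 / (real k + 3)) \<cdot>\<^sub>m h_grad (\<eta> (Suc k) \<cdot>\<^sub>m X (Suc k))"
    and q: "\<And>k. q k \<in> carrier_vec n" "\<And>k. q k \<bullet> q k = 1"
      "\<And>k. M k *\<^sub>v q k = lambda_min (M k) \<cdot>\<^sub>v q k"
    and \<theta>: "\<And>k. is_arg_min (\<lambda>s. h (\<eta> k \<cdot>\<^sub>m X k + s \<cdot>\<^sub>m outer_square (q k)))
      (\<lambda>s. 0 \<le> s \<and> \<eta> k \<cdot>\<^sub>m X k + s \<cdot>\<^sub>m outer_square (q k) \<in> feas) (\<theta> k)"
    and X_Suc: "\<And>k. X (Suc k) = \<eta> k \<cdot>\<^sub>m X k + \<theta> k \<cdot>\<^sub>m outer_square (q k)"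
begin

definition x :: "nat \<Rightarrow> real mat" where
  "x k = \<eta> k \<cdot>\<^sub>m X k"

definition violation :: "nat \<Rightarrow> real" where
  "violation k = max 0 (- lambda_min (M k))"

definition slope :: "nat \<Rightarrow> real" where
  "slope k = q k \<bullet> (h_grad (x k) *\<^sub>v q k)"

text \<open>The constant term of the averaged tangent \<open>W \<mapsto> avg k + tr (M k W)\<close>, a lower bound of \<open>h\<close>. The
  tangents at the points \<open>x j\<close> have the constant terms \<open>h (x j)\<close>, since the scaling search makes the
  gradient orthogonal to \<open>x j\<close>.\<close>

primrec avg :: "nat \<Rightarrow> real" where
  "avg 0 = h (x 0)"
| "avg (Suc k) = (1 - 2 / (real k + 3)) * avg k + 2 / (real k + 3) * h (x (Suc k))"

lemma \<eta>_D: "0 \<le> \<eta> k" "x k \<in> feas"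
  using \<eta>[of k] by (auto simp: is_arg_min_def x_def)

lemma \<theta>_D: "0 \<le> \<theta> k" "X (Suc k) \<in> feas"
  using \<theta>[of k] by (auto simp: is_arg_min_def X_Suc)

lemma X_psd: "X k \<in> psd_cone n"
proof (induction k)
  case 0
  show ?case unfolding X_0 by (rule zero_psd)
next
  case (Suc k)
  show ?case unfolding X_Suc
    by (intro psd_cone_add psd_cone_smult Suc \<eta>_D(1) \<theta>_D(1) outer_square_psd q(1))
qed

lemma x_psd: "x k \<in> psd_cone n"
  unfolding x_def by (intro psd_cone_smult X_psd \<eta>_D(1))

lemma zero_line: "P \<in> carrier_mat n n \<Longrightarrow> 0\<^sub>m n n + s \<cdot>\<^sub>m P = (s \<cdot>\<^sub>m P :: real mat)"
  by (intro eq_matI) auto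

text \<open>Optimality of the scaling search along the ray through \<open>X k\<close>, which starts at the zero matrix.\<close>

lemma gradient_orthogonal: "trace_inner (h_grad (x k)) (x k) = 0"
proof -
  have c: "X k \<in> carrier_mat n n" by (rule psd_coneD(1)[OF X_psd])
  have "\<eta> k * trace_inner (h_grad (x k)) (X k) = 0"
    using line_search_optimality(2)[of "0\<^sub>m n n" "X k" "\<eta> k"] \<eta>[of k]
      psd_coneD(2)[OF zero_psd, of n] psd_coneD(2)[OF X_psd, of k]
    unfolding zero_line[OF c] x_def by blast
  moreover have "trace_inner (h_grad (x k)) (x k) = \<eta> k * trace_inner (h_grad (x k)) (X k)"
    by (subst (2) x_def) (rule trace_inner_linear(6)[OF c c sym_matsD[OF h_grad_sym]])
  ultimately show ?thesis by simp
qed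

lemma h_scaled_le: "h (x (Suc k)) \<le> h (X (Suc k))"
proof -
  have "1 \<cdot>\<^sub>m X (Suc k) = X (Suc k)"
    using psd_coneD(1)[OF X_psd, of "Suc k"] by (intro eq_matI) auto
  thus ?thesis using \<eta>[of "Suc k"] \<theta>_D(2)[of k]
    by (auto simp: is_arg_min_def x_def not_less dest!: spec[of _ 1])
qed

text \<open>The matrix \<open>q q\<^sup>T\<close> has trace \<open>1\<close>; the next scaling search can only lower the value, as it
  includes the factor \<open>1\<close>.\<close>

lemma decrease:
  assumes "0 \<le> s"
  shows "h (x (Suc k)) \<le> h (x k) + slope k * s + L * s\<^sup>2 / 2"
proof -
  have "h (X (Suc k)) \<le> h (x k) + trace_inner (h_grad (x k)) (outer_square (q k)) * s
      + L * (mat_trace (outer_square (q k)))\<^sup>2 * s\<^sup>2 / 2"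
    unfolding X_Suc x_def
    by (rule line_search_decrease[OF smooth L0 _ outer_square_psd[OF q(1)] _ assms \<theta>])
      (use x_psd \<eta>_D in \<open>auto simp: x_def\<close>)
  thus ?thesis using h_scaled_le[of k] trace_outer_square[OF q(1)] q(2)
      trace_inner_outer_square[OF sym_matsD[OF h_grad_sym] q(1)] by (simp add: slope_def)
qed

lemma Xs_D: "Xs \<in> psd_cone n" "Xs \<in> feas" "\<And>A. A \<in> psd_cone n \<Longrightarrow> A \<in> feas \<Longrightarrow> h Xs \<le> h A"
  using Xs by (auto simp: is_arg_min_def not_less)

lemma tangent_lower_bound: "h (x k) + trace_inner (h_grad (x k)) Xs \<le> h Xs"
proof -
  have c: "x k \<in> carrier_mat n n" "Xs \<in> carrier_mat n n"
    using psd_coneD(1)[OF x_psd] psd_coneD(1)[OF Xs_D(1)] by auto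
  have e: "x k + (Xs - x k) = Xs" using c by (intro eq_matI) auto
  have "h (x k) + trace_inner (h_grad (x k)) (Xs - x k) \<le> h (x k + (Xs - x k))"
    by (rule h_above_tangent)
      (use \<eta>_D Xs_D e psd_coneD(2)[OF x_psd] psd_coneD(2)[OF Xs_D(1)] in \<open>auto intro: sym_mats_arith\<close>)
  thus ?thesis unfolding e using gradient_orthogonal[of k]
      trace_inner_linear(5)[OF c(2,1) sym_matsD[OF h_grad_sym]] by simp
qed

lemma M_sym: "M k \<in> sym_mats n"
proof (induction k)
  case 0
  show ?case unfolding M_0 by (rule h_grad_sym)
next
  case (Suc k)
  show ?case unfolding M_Suc
    by (intro sym_mats_arith(1) sym_mats_arith(3)[OF Suc Suc] sym_mats_arith(3)[OF h_grad_sym h_grad_sym])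
qed

lemma avg_tangent_lower_bound: "avg k + trace_inner (M k) Xs \<le> h Xs"
proof (induction k)
  case 0
  show ?case using tangent_lower_bound[of 0] by (simp add: M_0 x_def)
next
  case (Suc k)
  let ?\<delta> = "2 / (real k + 3)"
  have c: "Xs \<in> carrier_mat n n" by (rule psd_coneD(1)[OF Xs_D(1)])
  have "avg (Suc k) + trace_inner (M (Suc k)) Xs
      = (1 - ?\<delta>) * (avg k + trace_inner (M k) Xs)
      + ?\<delta> * (h (x (Suc k)) + trace_inner (h_grad (x (Suc k))) Xs)"
    unfolding M_Suc x_def[symmetric] using sym_matsD[OF M_sym] sym_matsD[OF h_grad_sym] c
    by (simp add: trace_inner_linear[of _ n] algebra_simps del: times_divide_eq_left times_divide_eq_right)
  also have "\<dots> \<le> (1 - ?\<delta>) * h Xs + ?\<delta> * h Xs"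
    by (intro add_mono mult_left_mono Suc tangent_lower_bound) auto
  also have "\<dots> = h Xs" by (simp add: left_diff_distrib)
  finally show ?case .
qed

lemma avg_lower_bound: "avg k - violation k * mat_trace Xs \<le> h Xs"
  using avg_tangent_lower_bound[of k] trace_inner_ge_lambda_min[OF M_sym[of k] Xs_D(1)]
  by (simp add: violation_def)

lemma eigenvalue_form: "q k \<bullet> (M k *\<^sub>v q k) = lambda_min (M k)"
  unfolding q(3) using q(1,2) by simp

lemma violation_0: "violation 0 = max 0 (- slope 0)"
  using eigenvalue_form[of 0] by (simp add: violation_def slope_def M_0 x_def)

text \<open>If the smallest eigenvalue is negative, it equals the form of \<open>M (Suc k)\<close> at \<open>q (Suc k)\<close>, an average
  of the form of \<open>M k\<close>, which is at least \<open>- violation k\<close>, and of the current slope.\<close>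

lemma violation_Suc:
  "violation (Suc k) = 0 \<or>
   violation (Suc k) \<le> (1 - 2 / (real k + 3)) * violation k - 2 / (real k + 3) * slope (Suc k)"
proof (cases "lambda_min (M (Suc k)) < 0")
  case False
  thus ?thesis by (simp add: violation_def)
next
  case True
  let ?\<delta> = "2 / (real k + 3)" and ?q = "q (Suc k)"
  have c: "M k \<in> carrier_mat n n" "h_grad (x (Suc k)) \<in> carrier_mat n n"
    using sym_matsD[OF M_sym] sym_matsD[OF h_grad_sym] by auto
  have "lambda_min (M (Suc k)) = ?q \<bullet> (M (Suc k) *\<^sub>v ?q)" by (rule eigenvalue_form[symmetric])
  also have "\<dots> = (1 - ?\<delta>) * (?q \<bullet> (M k *\<^sub>v ?q)) + ?\<delta> * slope (Suc k)"
    unfolding M_Suc x_def[symmetric] slope_def using c q(1)[of "Suc k"]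
    by (simp add: add_mult_distrib_mat_vec[of _ n n] smult_mat_mult_vec[of _ n n]
        scalar_prod_add_distrib[of _ n])
  finally have e: "lambda_min (M (Suc k)) = (1 - ?\<delta>) * (?q \<bullet> (M k *\<^sub>v ?q)) + ?\<delta> * slope (Suc k)" .
  have "- violation k \<le> ?q \<bullet> (M k *\<^sub>v ?q)"
    using lambda_min_le_form[OF M_sym[of k] q(1)[of "Suc k"]] q(2) by (simp add: violation_def)
  hence "(1 - ?\<delta>) * - violation k \<le> (1 - ?\<delta>) * (?q \<bullet> (M k *\<^sub>v ?q))"
    by (intro mult_left_mono) auto
  thus ?thesis using e True by (simp add: violation_def)
qed

lemma violation_nonneg: "0 \<le> violation k"
  by (simp add: violation_def)

text \<open>The primal-dual gap over the truncated cone of matrices with trace at most \<open>R\<close>: the minimum of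
  the averaged tangent over that set is \<open>avg k - R * violation k\<close>. The recursion is that of the
  Frank-Wolfe method with step \<open>\<delta> R\<close> along \<open>q q\<^sup>T\<close>. The radius \<open>R\<close> occurs in the analysis only, so
  that the estimate holds for all \<open>R\<close> simultaneously.\<close>

theorem truncated_gap:
  assumes R: "0 \<le> R"
  shows "h (x (Suc k)) - avg k + R * violation k \<le> 2 * (L * R\<^sup>2) / (real k + 2)"
proof (induction k)
  case 0
  have "h (x (Suc 0)) \<le> h (x 0) - R * violation 0 + L * R\<^sup>2 / 2"
  proof (cases "slope 0 < 0")
    case True
    thus ?thesis using decrease[OF R, of 0] by (simp add: violation_0 mult.commute)
  next
    case False
    have "0 \<le> L * R\<^sup>2 / 2" using L0 by simp
    thus ?thesis using False decrease[of 0 0] by (simp add: violation_0)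
  qed
  moreover have "0 \<le> L * R\<^sup>2" using L0 by simp
  ultimately show ?case by simp
next
  case (Suc k)
  let ?\<delta> = "2 / (real k + 3)"
  have B: "0 \<le> L * R\<^sup>2" using L0 by simp
  have step: "h (x (Suc (Suc k))) + R * violation (Suc k)
      \<le> h (x (Suc k)) + (1 - ?\<delta>) * (R * violation k) + L * R\<^sup>2 * ?\<delta>\<^sup>2 / 2"
    using violation_Suc[of k]
  proof
    assume 0: "violation (Suc k) = 0"
    have "0 \<le> (1 - ?\<delta>) * (R * violation k)" "0 \<le> L * R\<^sup>2 * ?\<delta>\<^sup>2 / 2"
      using R violation_nonneg L0 by auto
    thus ?thesis using decrease[of 0 "Suc k"] 0 by simp
  next
    assume "violation (Suc k) \<le> (1 - ?\<delta>) * violation k - ?\<delta> * slope (Suc k)"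
    from mult_left_mono[OF this R]
    have "R * violation (Suc k) \<le> (1 - ?\<delta>) * (R * violation k) - slope (Suc k) * (?\<delta> * R)"
      by (simp add: right_diff_distrib mult_ac)
    moreover have "h (x (Suc (Suc k))) \<le> h (x (Suc k)) + slope (Suc k) * (?\<delta> * R) + L * (?\<delta> * R)\<^sup>2 / 2"
      by (rule decrease) (use R in auto)
    moreover have "L * (?\<delta> * R)\<^sup>2 / 2 = L * R\<^sup>2 * ?\<delta>\<^sup>2 / 2" by (simp only: power_mult_distrib mult_ac)
    ultimately show ?thesis by linarith
  qed
  have "h (x (Suc (Suc k))) - avg (Suc k) + R * violation (Suc k)
      \<le> (1 - ?\<delta>) * (h (x (Suc k)) - avg k + R * violation k) + L * R\<^sup>2 * ?\<delta>\<^sup>2 / 2"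
    using step by (simp add: algebra_simps del: times_divide_eq_left times_divide_eq_right)
  also have "\<dots> \<le> (1 - ?\<delta>) * (2 * (L * R\<^sup>2) / (real k + 2)) + L * R\<^sup>2 * ?\<delta>\<^sup>2 / 2"
    by (intro add_right_mono mult_left_mono Suc) auto
  also have "\<dots> \<le> 2 * (L * R\<^sup>2) / (real (Suc k) + 2)" by (rule rate_recursion[OF B])
  finally show ?case .
qed

abbreviation (input) \<tau> :: real where "\<tau> \<equiv> mat_trace Xs"

text \<open>For positive \<open>k\<close> this is the gap with \<open>R = tr X\<^sup>*\<close>. At \<open>k = 0\<close>, where no gap estimate is available,
  smoothness along the segment from the zero matrix to \<open>X\<^sup>*\<close> and the optimality of \<open>X\<^sup>*\<close> bound the
  initial error.\<close>

lemma objective_rate: "h (x k) - h Xs \<le> 2 * (L * \<tau>\<^sup>2) / (real k + 1)"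
proof (cases k)
  case 0
  have c: "Xs \<in> carrier_mat n n" by (rule psd_coneD(1)[OF Xs_D(1)])
  have x0: "x 0 = 0\<^sub>m n n" by (simp add: x_def X_0)
  have one: "0\<^sub>m n n + 1 \<cdot>\<^sub>m Xs = Xs" using c by (intro eq_matI) auto
  have ray: "is_arg_min (\<lambda>s. h (0\<^sub>m n n + s \<cdot>\<^sub>m Xs)) (\<lambda>s. 0 \<le> s \<and> 0\<^sub>m n n + s \<cdot>\<^sub>m Xs \<in> feas) 1"
    unfolding is_arg_min_def one using Xs_D psd_cone_smult[OF Xs_D(1)]
    by (auto simp: zero_line[OF c] not_less)
  have "0 \<le> trace_inner (h_grad Xs) Xs"
    using line_search_optimality(1)[OF psd_coneD(2)[OF zero_psd] psd_coneD(2)[OF Xs_D(1)] ray] one by simp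
  moreover have "h (x 0) \<le> h Xs - trace_inner (h_grad Xs) Xs + L * \<tau>\<^sup>2 / 2"
    using cone_smooth_quadratic_bounds(2)[OF smooth zero_psd Xs_D(1), of 1] one Xs_D(2) \<eta>_D(2)[of 0]
    by (simp add: x0)
  moreover have "0 \<le> L * \<tau>\<^sup>2" using L0 by simp
  ultimately show ?thesis using 0 by simp
next
  case (Suc j)
  have "h (x (Suc j)) - h Xs \<le> h (x (Suc j)) - avg j + \<tau> * violation j"
    using avg_lower_bound[of j] by (simp add: mult.commute)
  also have "\<dots> \<le> 2 * (L * \<tau>\<^sup>2) / (real j + 2)"
    by (rule truncated_gap[OF psd_trace_nonneg[OF Xs_D(1)]])
  finally show ?thesis using Suc by (simp add: add.commute)
qed

lemma avg_rate: "avg k - h Xs \<le> 4 * (L * \<tau>\<^sup>2) / (real k + 2)"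
proof (induction k)
  case 0
  show ?case using objective_rate[of 0] by simp
next
  case (Suc k)
  let ?\<delta> = "2 / (real k + 3)" and ?B = "L * \<tau>\<^sup>2"
  have "avg (Suc k) - h Xs = (1 - ?\<delta>) * (avg k - h Xs) + ?\<delta> * (h (x (Suc k)) - h Xs)"
    by (simp add: algebra_simps del: times_divide_eq_left times_divide_eq_right)
  also have "\<dots> \<le> (1 - ?\<delta>) * (4 * ?B / (real k + 2)) + ?\<delta> * (2 * ?B / (real (Suc k) + 1))"
    by (intro add_mono mult_left_mono Suc objective_rate) (auto simp: divide_le_eq)
  also have "1 - ?\<delta> = (real k + 1) / (real k + 3)" by (simp add: field_simps)
  also have "(real k + 1) / (real k + 3) * (4 * ?B / (real k + 2)) + ?\<delta> * (2 * ?B / (real (Suc k) + 1))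
      = 4 * ?B / (real k + 3) * ((real k + 1) / (real k + 2) + 1 / (real k + 2))"
    by (simp only: distrib_left) (simp add: add.commute)
  also have "(real k + 1) / (real k + 2) + 1 / (real k + 2) = 1" by (simp add: field_simps)
  also have "4 * ?B / (real k + 3) * 1 = 4 * ?B / (real (Suc k) + 2)" by simp
  finally show ?case .
qed

lemma violation_bound_radius:
  assumes "0 \<le> R"
  shows "R * violation k \<le> (2 * (L * R\<^sup>2) + 4 * (L * \<tau>\<^sup>2)) / (real k + 2)"
  using truncated_gap[OF assms, of k] avg_rate[of k] Xs_D(3)[OF x_psd \<eta>_D(2), of "Suc k"]
  by (simp add: add_divide_distrib)

text \<open>The radius is now chosen as the trace of the solution. If that trace is zero, letting the radius
  tend to zero gives the same bound.\<close>

theorem violation_rate: "violation k \<le> 6 * L * \<tau> / (real k + 2)"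
proof (cases "\<tau> = 0")
  case False
  hence \<tau>: "\<tau> > 0" using psd_trace_nonneg[OF Xs_D(1)] by simp
  have "\<tau> * violation k \<le> (2 * (L * \<tau>\<^sup>2) + 4 * (L * \<tau>\<^sup>2)) / (real k + 2)"
    by (rule violation_bound_radius) (use \<tau> in simp)
  also have "\<dots> = \<tau> * (6 * L * \<tau> / (real k + 2))" by (simp add: power2_eq_square)
  finally show ?thesis using \<tau> by (simp only: mult_le_cancel_left_pos)
next
  case True
  have "violation k \<le> 0"
  proof (rule ccontr)
    assume "\<not> violation k \<le> 0"
    (* R is chosen so small that the estimate violation k <= 2 L R fails; the 1 covers L = 0. *)
    define R where "R = violation k / (2 * L + 1)"
    have den: "2 * L + 1 > 0" using L0 by simp
    have R: "R > 0" using \<open>\<not> violation k \<le> 0\<close> den by (simp add: R_def)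
    have "R * violation k \<le> 2 * (L * R\<^sup>2) / (real k + 2)"
      using violation_bound_radius[of R k] R True by simp
    also have "\<dots> \<le> 2 * (L * R\<^sup>2) / 1" using L0 by (intro divide_left_mono) auto
    also have "\<dots> = R * (2 * L * R)" by (simp add: power2_eq_square)
    finally have "violation k \<le> 2 * L * R" using R by simp
    moreover have "violation k = (2 * L + 1) * R" using den by (simp add: R_def)
    hence "violation k = 2 * L * R + R" by (simp only: distrib_right mult_1)
    ultimately show False using R by simp
  qed
  thus ?thesis using True by simp
qed

theorem dist_op_rate: "dist_op (M k) (psd_cone n) \<le> 6 * L * \<tau> / (real k + 2)"
  by (rule order_trans[OF dist_op_psd_le(2)[OF M_sym, folded violation_def] violation_rate])

end

section \<open>The two smoothness constants\<close>

context psd_composite_problem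
begin

lemma cone_smooth_of_matrix_lipschitz:
  assumes lip: "lipschitz_gradient (sym_mats n) trace_inner nuclear_norm op_norm feas h L"
  shows "cone_smooth L"
  unfolding cone_smooth_def
proof (intro ballI impI)
  fix A P assume A: "A \<in> psd_cone n" and P: "P \<in> psd_cone n" and f: "A \<in> feas" "A + P \<in> feas"
  have "(A + P) - A = P"
    using psd_coneD(1)[OF A] psd_coneD(1)[OF P] by (intro eq_matI) auto
  moreover have "op_norm (gradient (sym_mats n) trace_inner h (A + P) - gradient (sym_mats n) trace_inner h A)
      \<le> L * nuclear_norm ((A + P) - A)"
    using lip f unfolding lipschitz_gradient_def by blast
  ultimately show "op_norm (h_grad (A + P) - h_grad A) \<le> L * mat_trace P"
    using f by (simp add: gradient_h nuclear_norm_psd[OF P])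
qed

text \<open>The bound on the adjoint dualizes to a bound on \<open>\<G>\<close> itself: test \<open>\<G> P\<close> with a functional that
  attains its norm.\<close>

lemma norm_G_map_psd:
  assumes N: "is_vec_norm d N"
    and adj: "\<And>a. a \<in> carrier_vec d \<Longrightarrow> op_norm (G_adj n d G a) \<le> Gbar * dual_norm d N a"
    and Gbar: "0 \<le> Gbar" and P: "P \<in> psd_cone n"
  shows "N (G_map d G P) \<le> Gbar * mat_trace P"
proof -
  obtain a where a: "a \<in> carrier_vec d" "a \<bullet> G_map d G P = N (G_map d G P)" "dual_norm d N a \<le> 1"
    using norming_functional[OF N G_map_carrier] by blast
  have "N (G_map d G P) = trace_inner (G_adj n d G a) P"
    using trace_inner_G_adj[OF G psd_coneD(1)[OF P]] a(2) by simp
  also have "\<dots> \<le> op_norm (G_adj n d G a) * mat_trace P"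
    by (rule trace_inner_le_op_norm[OF G_adj_sym[OF G] P])
  also have "\<dots> \<le> (Gbar * 1) * mat_trace P"
    using order_trans[OF adj[OF a(1)] mult_left_mono[OF a(3) Gbar]]
    by (intro mult_right_mono psd_trace_nonneg[OF P])
  finally show ?thesis by simp
qed

lemma h_grad_diff:
  assumes "A \<in> feas" "B \<in> feas"
  shows "h_grad B - h_grad A = G_adj n d G (f_grad (G_map d G B - z) - f_grad (G_map d G A - z))"
  unfolding h_grad_def
  by (rule G_adj_linear(2)[symmetric]) (use assms feasD f_grad_carrier in auto)

lemma cone_smooth_of_vector_lipschitz:
  assumes N: "is_vec_norm d N"
    and lip: "lipschitz_gradient (carrier_vec d) (\<bullet>) N (dual_norm d N) D f Lf"
    and adj: "\<And>a. a \<in> carrier_vec d \<Longrightarrow> op_norm (G_adj n d G a) \<le> Gbar * dual_norm d N a"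
    and Gbar: "0 \<le> Gbar" and Lf: "0 \<le> Gbar * Lf"
  shows "cone_smooth (Gbar\<^sup>2 * Lf)"
  unfolding cone_smooth_def
proof (intro ballI impI)
  fix A P assume A: "A \<in> psd_cone n" and P: "P \<in> psd_cone n" and f: "A \<in> feas" "A + P \<in> feas"
  let ?u = "G_map d G A - z" and ?w = "G_map d G (A + P) - z"
  let ?a = "f_grad ?w - f_grad ?u"
  have ac: "?a \<in> carrier_vec d" using f feasD f_grad_carrier by simp
  have "?w - ?u = G_map d G P"
    using G_map_add[OF psd_coneD(1)[OF A] psd_coneD(1)[OF P]] z carrier_vecD[OF G_map_carrier]
    by (intro eq_vecI) auto
  hence dual: "dual_norm d N ?a \<le> Lf * N (G_map d G P)"
    using lip feasD(2)[OF f(1)] feasD(2)[OF f(2)] unfolding lipschitz_gradient_def f_grad_def by metis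
  have "op_norm (h_grad (A + P) - h_grad A) \<le> Gbar * dual_norm d N ?a"
    unfolding h_grad_diff[OF f] by (rule adj[OF ac])
  also have "\<dots> \<le> Gbar * (Lf * N (G_map d G P))" by (rule mult_left_mono[OF dual Gbar])
  also have "\<dots> = (Gbar * Lf) * N (G_map d G P)" by simp
  also have "\<dots> \<le> (Gbar * Lf) * (Gbar * mat_trace P)"
    by (rule mult_left_mono[OF norm_G_map_psd[OF N adj Gbar P] Lf])
  finally show "op_norm (h_grad (A + P) - h_grad A) \<le> Gbar\<^sup>2 * Lf * mat_trace P"
    by (simp add: power2_eq_square mult_ac)
qed

lemma adjoint_bound_nonneg:
  assumes N: "is_vec_norm d N" and d: "1 \<le> d"
    and adj: "\<And>a. a \<in> carrier_vec d \<Longrightarrow> op_norm (G_adj n d G a) \<le> Gbar * dual_norm d N a"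
  shows "0 \<le> Gbar"
proof -
  have e: "unit_vec d 0 \<noteq> (0\<^sub>v d :: real vec)" using d by simp
  obtain a where a: "a \<in> carrier_vec d" "dual_norm d N a = 1"
    using norming_functional[OF N unit_vec_carrier[of d 0]] e by metis
  have "0 \<le> op_norm (G_adj n d G a)" by (rule op_norm_nonneg[OF sym_matsD[OF G_adj_sym[OF G]]])
  thus ?thesis using adj[OF a(1)] a(2) by simp
qed

text \<open>The dual norm of a gradient difference is nonnegative since it dominates an operator norm up to
  the positive factor \<open>Gbar\<close>. As \<open>D\<close> is open and \<open>d \<ge> 1\<close>, there is a second point in \<open>D\<close> to compare
  with.\<close>

lemma vector_lipschitz_nonneg:
  assumes N: "is_vec_norm d N" and d: "1 \<le> d" and u: "u \<in> D" and Gbar: "0 < Gbar"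
    and lip: "lipschitz_gradient (carrier_vec d) (\<bullet>) N (dual_norm d N) D f Lf"
    and adj: "\<And>a. a \<in> carrier_vec d \<Longrightarrow> op_norm (G_adj n d G a) \<le> Gbar * dual_norm d N a"
  shows "0 \<le> Lf"
proof -
  let ?e = "unit_vec d 0 :: real vec"
  have uc: "u \<in> carrier_vec d" by (rule D_carrier[OF u])
  obtain r where r: "r > 0" "\<And>t. \<bar>t\<bar> < r \<Longrightarrow> u + t \<cdot>\<^sub>v ?e \<in> D"
    using D_line_open[OF u unit_vec_carrier] by blast
  define w where "w = u + (r / 2) \<cdot>\<^sub>v ?e"
  have w: "w \<in> D" unfolding w_def using r by (intro r(2)) auto
  have wu: "w - u = (r / 2) \<cdot>\<^sub>v ?e" unfolding w_def using uc by (intro eq_vecI) auto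
  have Ne: "N ?e > 0" using N d unfolding is_vec_norm_def by (metis less_eq_real_def unit_vec_carrier unit_vec_nonzero less_eq_Suc_le One_nat_def)
  have Nw: "N (w - u) > 0"
    unfolding wu using N Ne r(1) by (simp add: is_vec_norm_def)
  let ?a = "f_grad w - f_grad u"
  have ac: "?a \<in> carrier_vec d" using f_grad_carrier[OF u] f_grad_carrier[OF w] by simp
  have "0 \<le> op_norm (G_adj n d G ?a)" by (rule op_norm_nonneg[OF sym_matsD[OF G_adj_sym[OF G]]])
  hence "0 \<le> Gbar * dual_norm d N ?a" using adj[OF ac] by simp
  hence "0 \<le> dual_norm d N ?a" using Gbar by (simp add: zero_le_mult_iff)
  also have "\<dots> \<le> Lf * N (w - u)"
    using lip u w unfolding lipschitz_gradient_def f_grad_def by blast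
  finally show ?thesis using Nw by (simp add: zero_le_mult_iff)
qed

text \<open>A small multiple of the identity is a direction of positive trace that stays in the domain.\<close>

lemma cone_smooth_nonneg:
  assumes L: "cone_smooth L" and n: "1 \<le> n" and feas0: "0\<^sub>m n n \<in> feas"
  shows "0 \<le> L"
proof -
  have shift: "0\<^sub>m n n + t \<cdot>\<^sub>m 1\<^sub>m n = (t \<cdot>\<^sub>m 1\<^sub>m n :: real mat)" for t by (intro eq_matI) auto
  have "0\<^sub>m n n + 0 \<cdot>\<^sub>m 1\<^sub>m n = (0\<^sub>m n n :: real mat)" by (intro eq_matI) auto
  then obtain r where r: "r > 0" "\<And>t. \<bar>t - 0\<bar> < r \<Longrightarrow> 0\<^sub>m n n + t \<cdot>\<^sub>m 1\<^sub>m n \<in> feas"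
    using feas_line_open[OF psd_coneD(2)[OF zero_psd] one_sym_mats, where t = 0] feas0 by metis
  let ?P = "(r / 2) \<cdot>\<^sub>m 1\<^sub>m n :: real mat"
  have P: "?P \<in> psd_cone n" using r(1) by (intro psd_cone_smult one_psd) simp
  have fP: "0\<^sub>m n n + ?P \<in> feas" using r by (intro r(2)) simp
  have "0 \<le> op_norm (h_grad (0\<^sub>m n n + ?P) - h_grad (0\<^sub>m n n))"
    by (rule op_norm_nonneg[OF sym_matsD[OF sym_mats_arith(2)[OF h_grad_sym h_grad_sym]]])
  also have "\<dots> \<le> L * mat_trace ?P"
    using L zero_psd P feas0 fP unfolding cone_smooth_def by blast
  also have "mat_trace ?P = r / 2 * real n" by (simp add: mat_trace_def)
  finally have "0 \<le> L * (r / 2 * real n)" .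
  moreover have "0 < r / 2 * real n" using r(1) n by simp
  ultimately show ?thesis by (simp only: zero_le_mult_iff) linarith
qed

section \<open>From the vector iteration to the matrix iteration\<close>

text \<open>By induction \<open>y k = \<G> (X k) - z\<close>, so that scaling \<open>X k\<close> by \<open>s\<close> gives the residual
  \<open>s y\<^sub>k + s z - z\<close> of the scaling search, and adding \<open>s q q\<^sup>T\<close> that of the second search. The initial
  momentum vector drops out because its weight is \<open>0\<close>.\<close>

lemma moco_run_matrix_moco:
  assumes run: "moco_run n d D f G z y X \<eta> g_init g lam q \<theta>"
    and L: "cone_smooth L" "0 \<le> L"
    and Xs: "is_arg_min h (\<lambda>A. A \<in> psd_cone n \<and> A \<in> feas) Xs"
  shows "matrix_moco n d D f G z L Xs X (\<lambda>k. G_adj n d G (g k)) \<eta> \<theta> q"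
proof -
  have y0: "y 0 = - z" and X0: "X 0 = 0\<^sub>m n n" and gi: "g_init \<in> carrier_vec d"
    using run unfolding moco_run_def by auto
  define p where "p k s = s \<cdot>\<^sub>v y k + s \<cdot>\<^sub>v z - z" for k s
  note step = run[unfolded moco_run_def Let_def, THEN conjunct2, THEN conjunct2, THEN conjunct2,
      rule_format, folded p_def]
  have \<eta>: "is_arg_min (\<lambda>s. f (p k s)) (\<lambda>s. 0 \<le> s \<and> p k s \<in> D) (\<eta> k)"
    and g: "g k = (1 - 2 / (real k + 2)) \<cdot>\<^sub>v (case k of 0 \<Rightarrow> g_init | Suc j \<Rightarrow> g j)
                   + (2 / (real k + 2)) \<cdot>\<^sub>v f_grad (p k (\<eta> k))"
    and lam: "lam k = lambda_min (G_adj n d G (g k))"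
    and ev: "eigenvector (G_adj n d G (g k)) (q k) (lam k)" and qq: "q k \<bullet> q k = 1"
    and \<theta>: "is_arg_min (\<lambda>s. f (p k (\<eta> k) + s \<cdot>\<^sub>v G_map d G (outer_square (q k))))
               (\<lambda>s. 0 \<le> s \<and> p k (\<eta> k) + s \<cdot>\<^sub>v G_map d G (outer_square (q k)) \<in> D) (\<theta> k)"
    and yS: "y (Suc k) = p k (\<eta> k) + \<theta> k \<cdot>\<^sub>v G_map d G (outer_square (q k))"
    and XS: "X (Suc k) = \<eta> k \<cdot>\<^sub>m X k + \<theta> k \<cdot>\<^sub>m outer_square (q k)" for k
    using step[of k] unfolding f_grad_def by auto
  have q: "q k \<in> carrier_vec n" "G_adj n d G (g k) *\<^sub>v q k = lambda_min (G_adj n d G (g k)) \<cdot>\<^sub>v q k" for k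
    using ev[of k] lam[of k] by (auto simp: eigenvector_def G_adj_def)
  have qs: "outer_square (q k) \<in> sym_mats n" for k by (rule psd_coneD(2)[OF outer_square_psd[OF q(1)]])
  have p_X: "p k s = G_map d G (s \<cdot>\<^sub>m X k) - z" if "X k \<in> sym_mats n" "y k = G_map d G (X k) - z" for k s
    unfolding p_def that(2) G_map_smult[OF sym_matsD[OF that(1)]]
    using z carrier_vecD[OF G_map_carrier] by (intro eq_vecI) (auto simp: algebra_simps)
  have inv: "X k \<in> sym_mats n \<and> y k = G_map d G (X k) - z" for k
  proof (induction k)
    case 0
    show ?case using z psd_coneD(2)[OF zero_psd] by (simp add: X0 y0 G_map_zero)
  next
    case (Suc k)
    have "\<eta> k \<cdot>\<^sub>m X k \<in> sym_mats n" using Suc sym_mats_arith(3) by blast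
    thus ?case unfolding XS yS using residual_add[OF _ qs] p_X[of k] Suc sym_mats_line[OF _ qs] by simp
  qed
  have Xc: "X k \<in> sym_mats n" for k using inv by blast
  have sX: "s \<cdot>\<^sub>m X k \<in> sym_mats n" for s k by (rule sym_mats_arith(3)[OF Xc Xc])
  have p_eq: "p k s = G_map d G (s \<cdot>\<^sub>m X k) - z" for k s using p_X inv by blast
  have \<eta>': "is_arg_min (\<lambda>s. h (s \<cdot>\<^sub>m X k)) (\<lambda>s. 0 \<le> s \<and> s \<cdot>\<^sub>m X k \<in> feas) (\<eta> k)" for k
    using \<eta>[of k] sX by (simp add: p_eq h_def feas_def)
  have \<theta>': "is_arg_min (\<lambda>s. h (\<eta> k \<cdot>\<^sub>m X k + s \<cdot>\<^sub>m outer_square (q k)))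
      (\<lambda>s. 0 \<le> s \<and> \<eta> k \<cdot>\<^sub>m X k + s \<cdot>\<^sub>m outer_square (q k) \<in> feas) (\<theta> k)" for k
    using \<theta>[of k] sym_mats_line[OF sX qs]
    by (simp add: p_eq h_def feas_def residual_add[OF sX qs])
  have pD: "p k (\<eta> k) \<in> D" for k using \<eta>[of k] by (auto simp: is_arg_min_def)
  have gc: "g k \<in> carrier_vec d" for k
  proof (induction k)
    case 0
    show ?case unfolding g[of 0] using gi f_grad_carrier[OF pD[of 0]] by simp
  next
    case (Suc k)
    show ?case unfolding g[of "Suc k"] using Suc f_grad_carrier[OF pD[of "Suc k"]] by simp
  qed
  have hg: "h_grad (\<eta> k \<cdot>\<^sub>m X k) = G_adj n d G (f_grad (p k (\<eta> k)))" for k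
    by (simp add: h_grad_def p_eq)
  show ?thesis
  proof (unfold_locales)
    show "G_adj n d G (g 0) = h_grad (\<eta> 0 \<cdot>\<^sub>m X 0)"
    proof -
      have "g 0 = f_grad (p 0 (\<eta> 0))"
        unfolding g[of 0] using gi f_grad_carrier[OF pD[of 0]] by (intro eq_vecI) auto
      thus ?thesis by (simp add: hg)
    qed
    fix k
    have "g (Suc k) = (1 - 2 / (real k + 3)) \<cdot>\<^sub>v g k + (2 / (real k + 3)) \<cdot>\<^sub>v f_grad (p (Suc k) (\<eta> (Suc k)))"
      using g[of "Suc k"] by (simp add: add.commute)
    thus "G_adj n d G (g (Suc k)) = (1 - 2 / (real k + 3)) \<cdot>\<^sub>m G_adj n d G (g k)
      + (2 / (real k + 3)) \<cdot>\<^sub>m h_grad (\<eta> (Suc k) \<cdot>\<^sub>m X (Suc k))"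
      using G_adj_linear(1)[of "(1 - 2 / (real k + 3)) \<cdot>\<^sub>v g k" d
          "(2 / (real k + 3)) \<cdot>\<^sub>v f_grad (p (Suc k) (\<eta> (Suc k)))" n G]
        G_adj_linear(3)[OF gc[of k] gc[of k]] f_grad_carrier[OF pD[of "Suc k"]] gc[of k]
        G_adj_linear(3)[OF f_grad_carrier[OF pD[of "Suc k"]] gc[of k]]
      by (simp add: hg)
  qed (use L Xs X0 \<eta>' q qq \<theta>' XS in auto)
qed

end

section \<open>The convergence rate\<close>

lemma min_power2_le_mult:
  fixes a b :: real
  assumes "0 \<le> a" "0 \<le> b"
  shows "(min a b)\<^sup>2 \<le> a * b"
  using assms by (auto simp: power2_eq_square min_def intro: mult_left_mono mult_right_mono)

theorem theorem3:
  shows "\<exists>C::real. C > 0 \<and>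
    (\<forall>(n::nat) (d::nat) (D::real vec set) (f::real vec \<Rightarrow> real) (G::nat \<Rightarrow> real mat) (z::real vec)
      (N::real vec \<Rightarrow> real) (L_fG::real) (L_f::real) (Gbar::real) (Xs::real mat)
      (y::nat \<Rightarrow> real vec) (X::nat \<Rightarrow> real mat) (\<eta>::nat \<Rightarrow> real) (g_init::real vec)
      (g::nat \<Rightarrow> real vec) (lam::nat \<Rightarrow> real) (q::nat \<Rightarrow> real vec) (\<theta>::nat \<Rightarrow> real).
      n \<ge> 1 \<longrightarrow> d \<ge> 1 \<longrightarrow>
      z \<in> carrier_vec d \<longrightarrow>
      (\<forall>i<d. G i \<in> sym_mats n) \<longrightarrow>
      is_vec_norm d N \<longrightarrow>
      open_subset (carrier_vec d) (\<bullet>) D \<longrightarrow>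
      differentiable_on_set (carrier_vec d) (\<bullet>) D f \<longrightarrow>
      lipschitz_gradient (sym_mats n) trace_inner nuclear_norm op_norm
        {A \<in> sym_mats n. G_map d G A - z \<in> D} (\<lambda>A. f (G_map d G A - z)) L_fG \<longrightarrow>
      lipschitz_gradient (carrier_vec d) (\<bullet>) N (dual_norm d N) D f L_f \<longrightarrow>
      strictly_convex_on D f \<longrightarrow>
      (\<forall>a \<in> carrier_vec d. op_norm (G_adj n d G a) \<le> Gbar * dual_norm d N a) \<longrightarrow>
      is_arg_min (\<lambda>A. f (G_map d G A - z)) (\<lambda>A. A \<in> psd_cone n \<and> G_map d G A - z \<in> D) Xs \<longrightarrow>
      moco_run n d D f G z y X \<eta> g_init g lam q \<theta> \<longrightarrow>
      (\<forall>k\<ge>1. (dist_op (G_adj n d G (g k)) (psd_cone n))\<^sup>2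
               \<le> C * (Gbar\<^sup>2 * L_f * L_fG * (nuclear_norm Xs)\<^sup>2 / real k)))"
proof (intro exI[of _ 36] conjI allI impI)
  fix n d :: nat and D :: "real vec set" and f :: "real vec \<Rightarrow> real" and G :: "nat \<Rightarrow> real mat"
    and z :: "real vec" and N :: "real vec \<Rightarrow> real" and L_fG L_f Gbar :: real and Xs :: "real mat"
    and y :: "nat \<Rightarrow> real vec" and X :: "nat \<Rightarrow> real mat" and \<eta> :: "nat \<Rightarrow> real" and g_init :: "real vec"
    and g :: "nat \<Rightarrow> real vec" and lam :: "nat \<Rightarrow> real" and q :: "nat \<Rightarrow> real vec" and \<theta> :: "nat \<Rightarrow> real"
    and k :: nat
  assume n: "n \<ge> 1" and d: "d \<ge> 1" and z: "z \<in> carrier_vec d" and G: "\<forall>i<d. G i \<in> sym_mats n"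
    and N: "is_vec_norm d N" and D: "open_subset (carrier_vec d) (\<bullet>) D"
    and diff: "differentiable_on_set (carrier_vec d) (\<bullet>) D f"
    and lipG: "lipschitz_gradient (sym_mats n) trace_inner nuclear_norm op_norm
        {A \<in> sym_mats n. G_map d G A - z \<in> D} (\<lambda>A. f (G_map d G A - z)) L_fG"
    and lipf: "lipschitz_gradient (carrier_vec d) (\<bullet>) N (dual_norm d N) D f L_f"
    and conv: "strictly_convex_on D f"
    and adj: "\<forall>a \<in> carrier_vec d. op_norm (G_adj n d G a) \<le> Gbar * dual_norm d N a"
    and Xs: "is_arg_min (\<lambda>A. f (G_map d G A - z)) (\<lambda>A. A \<in> psd_cone n \<and> G_map d G A - z \<in> D) Xs"
    and run: "moco_run n d D f G z y X \<eta> g_init g lam q \<theta>" and k: "1 \<le> k"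
  interpret psd_composite_problem n d D f G z
    by unfold_locales (use z G D diff conv in auto)
  have adj': "op_norm (G_adj n d G a) \<le> Gbar * dual_norm d N a" if "a \<in> carrier_vec d" for a
    using adj that by blast
  have Gbar: "0 \<le> Gbar" by (rule adjoint_bound_nonneg[OF N d adj'])
  have h_eq: "h = (\<lambda>A. f (G_map d G A - z))" by (auto simp: h_def)
  have Xs': "is_arg_min h (\<lambda>A. A \<in> psd_cone n \<and> A \<in> feas) Xs"
    using Xs psd_coneD(2) unfolding is_arg_min_def h_eq feas_def by blast
  have Xs_psd: "Xs \<in> psd_cone n" and Xs_feas: "Xs \<in> feas" using Xs' by (auto simp: is_arg_min_def)
  have u: "G_map d G Xs - z \<in> D" by (rule feasD(2)[OF Xs_feas])
  have GL: "0 \<le> Gbar * L_f"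
  proof (cases "Gbar = 0")
    case False
    hence "0 < Gbar" using Gbar by simp
    thus ?thesis using vector_lipschitz_nonneg[OF N d u _ lipf adj'] by simp
  qed simp
  have s1: "cone_smooth L_fG"
    by (rule cone_smooth_of_matrix_lipschitz) (use lipG in \<open>simp add: h_eq feas_def\<close>)
  have s2: "cone_smooth (Gbar\<^sup>2 * L_f)"
    by (rule cone_smooth_of_vector_lipschitz[OF N lipf adj' Gbar GL])
  have feas0: "0\<^sub>m n n \<in> feas"
  proof -
    have "is_arg_min (\<lambda>s. f (s \<cdot>\<^sub>v y 0 + s \<cdot>\<^sub>v z - z)) (\<lambda>s. 0 \<le> s \<and> s \<cdot>\<^sub>v y 0 + s \<cdot>\<^sub>v z - z \<in> D) (\<eta> 0)"
      using run unfolding moco_run_def Let_def by blast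
    hence "\<eta> 0 \<cdot>\<^sub>v y 0 + \<eta> 0 \<cdot>\<^sub>v z - z \<in> D" by (simp add: is_arg_min_def)
    moreover have "y 0 = - z" using run unfolding moco_run_def by blast
    moreover have "\<eta> 0 \<cdot>\<^sub>v (- z) + \<eta> 0 \<cdot>\<^sub>v z - z = 0\<^sub>v d - z" using z by (intro eq_vecI) auto
    ultimately show ?thesis using psd_coneD(2)[OF zero_psd] by (simp add: feas_def G_map_zero)
  qed
  have nn: "0 \<le> L_fG" "0 \<le> Gbar\<^sup>2 * L_f"
    using cone_smooth_nonneg[OF s1 n feas0] cone_smooth_nonneg[OF s2 n feas0] by auto
  let ?L = "min L_fG (Gbar\<^sup>2 * L_f)"
  have sL: "cone_smooth ?L" using s1 s2 by (simp add: min_def)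
  interpret M: matrix_moco n d D f G z ?L Xs X "\<lambda>k. G_adj n d G (g k)" \<eta> \<theta> q
    by (rule moco_run_matrix_moco[OF run sL _ Xs']) (use nn in simp)
  let ?d = "dist_op (G_adj n d G (g k)) (psd_cone n)" and ?\<tau> = "mat_trace Xs"
  have "?d\<^sup>2 \<le> (6 * ?L * ?\<tau> / (real k + 2))\<^sup>2"
    by (intro power_mono M.dist_op_rate dist_op_psd_le(1) M.M_sym)
  also have "\<dots> = 36 * (?L\<^sup>2 * ?\<tau>\<^sup>2) / (real k + 2)\<^sup>2"
    by (simp add: power_divide power_mult_distrib)
  also have "\<dots> \<le> 36 * ((L_fG * (Gbar\<^sup>2 * L_f)) * ?\<tau>\<^sup>2) / real k"
  proof (rule frac_le)
    show "36 * (?L\<^sup>2 * ?\<tau>\<^sup>2) \<le> 36 * ((L_fG * (Gbar\<^sup>2 * L_f)) * ?\<tau>\<^sup>2)"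
      by (intro mult_left_mono mult_right_mono min_power2_le_mult nn) auto
    show "real k \<le> (real k + 2)\<^sup>2" by (simp add: power2_eq_square algebra_simps)
  qed (use nn k in auto)
  finally show "?d\<^sup>2 \<le> 36 * (Gbar\<^sup>2 * L_f * L_fG * (nuclear_norm Xs)\<^sup>2 / real k)"
    by (simp add: nuclear_norm_psd[OF Xs_psd] mult_ac)
qed simp

end
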